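(* Let $(Z_i)_{i\in\mathbb N}$ be i.i.d. $\mathbb R^d$-valued random variables such that $Z_1$ satisfies (A1) and (A2). Let $(\mathcal X,\rho)$ be a metric space, $\mathbf f:\mathcal X\to\mathbb R^{m\times d}$ continuous, and for each $n$ let $C_n\subset\{x_1^n,\dots,x_n^n\}\subset\mathcal X$ be such that $\mathrm{card}(C_n)/n\to 0$ as $n\to\infty$. Set $C_n^{\mathbf f}=\{\mathbf f(x_i^n):x_i^n\in C_n\}$ and assume that the sequence $(C_n^{\mathbf f})_{n\ge1}$ satisfies (A3) and (A4). Then $$\pi_n=\frac1n\sum_{x_i^n\in C_n}\mathbf f(x_i^n)\cdot Z_i$$ satisfies the LDP in $\mathbb R^m$ with good rate function $$\Delta^*(z\mid\mathcal D)=\sup\{\langle\lambda,z\rangle:\lambda\in\mathcal D\},\qquad \mathcal D=\bigcap_{\mathbf y\in C^{\mathbf f}_{\infty,\mathrm{in}}}\mathcal D_{\mathbf y}=\bigcap_{\mathbf y\in C^{\mathbf f}_{\infty,\mathrm{out}}}\mathcal D_{\mathbf y}.$$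
   Context: For $A\subset\mathbb R^k$, $\Delta(\theta\mid A)=0$ if $\theta\in A$ and $+\infty$ otherwise, and $\Delta^*(y\mid A)=\sup_{\theta\in A}\langle y,\theta\rangle$ (support function). For an $m\times d$ matrix $\mathbf y$, $\mathcal D_{\mathbf y}=\{\lambda\in\mathbb R^m:\log\mathbb E\,e^{\langle\lambda,\mathbf y\cdot Z_1\rangle}<\infty\}$, where $\mathbf y\cdot Z$ is the matrix-vector product. For a sequence $(D_n)$ of subsets of $\mathbb R^{m\times d}$: the outer limit $D_{\infty,\mathrm{out}}$ is the set of $\mathbf x$ such that there exist an increasing $\phi:\mathbb N\to\mathbb N$ and $\mathbf x_{\phi(n)}\in D_{\phi(n)}$ with $\mathbf x_{\phi(n)}\to\mathbf x$; the inner limit $D_{\infty,\mathrm{in}}$ is the set of $\mathbf x$ such that there exist $n_0$ and $\mathbf x_n\in D_n$ for all $n\ge n_0$ with $\mathbf x_n\to\mathbf x$. $C^{\mathbf f}_{\infty,\mathrm{in}},C^{\mathbf f}_{\infty,\mathrm{out}}$ denote these limits for $D_n=C_n^{\mathbf f}$. Assumptions: (A1) $\mathbb E\,e^{\alpha|Z_1|}<\infty$ for some $\alpha>0$, and $Z_1/n$ satisfies the LDP with a good rate function $I$. (A2) With $\mathcal D_Z=\{\theta\in\mathbb R^d:\log\mathbb E\,e^{\langle\theta,Z_1\rangle}<\infty\}$, $I(z)=\Delta^*(z\mid\mathcal D_Z)$. (A3) The sets $D_n$ are nonempty and there is a compact $K\subset\mathbb R^{m\times d}$ with $D_n\subset K$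 for all $n$. (A4) $\bigcap_{\mathbf y\in D_{\infty,\mathrm{in}}}\mathcal D_{\mathbf y}=\bigcap_{\mathbf y\in D_{\infty,\mathrm{out}}}\mathcal D_{\mathbf y}$. *)

theory Defs
  imports "HOL-Probability.Probability"
begin

definition eln :: "real \<Rightarrow> ereal" where
  "eln p = (if p \<le> 0 then -\<infinity> else ereal (ln p))"

definition good_rate_function :: "('a::topological_space \<Rightarrow> ereal) \<Rightarrow> bool" where
  "good_rate_function I \<longleftrightarrow>
     (\<forall>x. 0 \<le> I x) \<and> (\<forall>a::real. closed {x. I x \<le> ereal a}) \<and>
     (\<forall>a::real. compact {x. I x \<le> ereal a})"

definition LDP :: "'b measure \<Rightarrow> (nat \<Rightarrow> 'b \<Rightarrow> 'a::topological_space) \<Rightarrow> ('a \<Rightarrow> ereal) \<Rightarrow> bool" where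
  "LDP M X I \<longleftrightarrow> good_rate_function I \<and>
     (\<forall>\<Gamma> \<in> sets borel.
        - (INF x\<in>interior \<Gamma>. I x)
          \<le> liminf (\<lambda>n. ereal (1 / real n) * eln (measure M {\<omega>\<in>space M. X n \<omega> \<in> \<Gamma>})) \<and>
        limsup (\<lambda>n. ereal (1 / real n) * eln (measure M {\<omega>\<in>space M. X n \<omega> \<in> \<Gamma>}))
          \<le> - (INF x\<in>closure \<Gamma>. I x))"

definition support_fun :: "('a::real_inner) set \<Rightarrow> 'a \<Rightarrow> ereal" where
  "support_fun A y = (SUP \<theta>\<in>A. ereal (inner y \<theta>))"

definition outer_limit :: "(nat \<Rightarrow> 'a::topological_space set) \<Rightarrow> 'a set" where
  "outer_limit D = {x. \<exists>\<phi> xs. strict_mono \<phi> \<and> (\<forall>n. xs n \<in> D (\<phi> n)) \<and> xs \<longlonglongrightarrow> x}"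

definition inner_limit :: "(nat \<Rightarrow> 'a::topological_space set) \<Rightarrow> 'a set" where
  "inner_limit D = {x. \<exists>n0 xs. (\<forall>n\<ge>n0. xs n \<in> D n) \<and> xs \<longlonglongrightarrow> x}"

definition mgf_domain :: "'b measure \<Rightarrow> ('b \<Rightarrow> 'c::real_inner) \<Rightarrow> 'c set" where
  "mgf_domain M Z = {\<theta>. (\<integral>\<^sup>+\<omega>. ennreal (exp (inner \<theta> (Z \<omega>))) \<partial>M) < \<infinity>}"

definition mat_mgf_domain :: "'b measure \<Rightarrow> ('b \<Rightarrow> real^'d) \<Rightarrow> real^'d^'m \<Rightarrow> (real^'m) set" where
  "mat_mgf_domain M Z y = {l. (\<integral>\<^sup>+\<omega>. ennreal (exp (inner l (y *v Z \<omega>))) \<partial>M) < \<infinity>}"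

end

theory Submission
  imports Defs
begin

text \<open>
  Upper bound: for \<open>\<lambda> \<in> \<D>\<close> and \<open>t < 1\<close>, every limit point \<open>y\<close> of the weights satisfies
  \<open>t y\<^sup>T\<lambda> \<in> interior \<D>\<^sub>Z\<close>, so by compactness the moment generating functions of \<open>f(x\<^sub>i) \<cdot> Z\<^sub>i\<close> at
  \<open>t\<lambda>\<close> are eventually bounded by one constant \<open>B\<close>.  As \<open>B ^ card C\<^sub>n\<close> is subexponential,
  Chernoff's bound has rate \<open>c\<close> on the half space \<open>\<langle>t\<lambda>, z\<rangle> > c\<close>, and a closed set on which the
  rate function exceeds \<open>c\<close> is covered by finitely many such half spaces.

  Lower bound: for distinct \<open>y\<^sub>1, \<dots>, y\<^sub>k\<close> in the inner limit and \<open>z = \<Sum>\<^sub>j y\<^sub>j w\<^sub>j\<close>, let \<open>k\<close> of the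
  variables be close to \<open>n w\<^sub>j\<close> and all others be bounded by a constant; the second event costs
  only \<open>p ^ card C\<^sub>n\<close>, so the rate at \<open>z\<close> is at most \<open>\<Sum>\<^sub>j I(w\<^sub>j)\<close>.  The infimum of these costs is
  a sublinear function of \<open>z\<close>, and by convex duality its lower semicontinuous hull is the support
  function of the \<open>\<lambda>\<close> with \<open>y\<^sup>T\<lambda> \<in> closure \<D>\<^sub>Z\<close> for all \<open>y\<close> in the inner limit.  Since \<open>0\<close> is
  interior to \<open>\<D>\<^sub>Z\<close>, replacing \<open>\<D>\<^sub>Z\<close> by its closure does not change that support function.
\<close>

subsection \<open>Matrix-vector products\<close>

lemma bounded_bilinear_matrix_vector_mult:
  "bounded_bilinear ((*v) :: real^'n^'m \<Rightarrow> real^'n \<Rightarrow> real^'m)"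
  unfolding bilinear_conv_bounded_bilinear[symmetric] bilinear_def
  by (auto intro!: linearI simp: matrix_vector_mult_add_rdistrib matrix_vector_right_distrib
      scaleR_matrix_vector_assoc matrix_vector_mult_scaleR)

lemma bounded_bilinear_vector_matrix_mult:
  "bounded_bilinear ((v*) :: real^'m \<Rightarrow> real^'n^'m \<Rightarrow> real^'n)"
  unfolding bilinear_conv_bounded_bilinear[symmetric] bilinear_def
  by (auto intro!: linearI simp: vector_eq_rdot[symmetric] dot_lmul_matrix inner_add_left
      inner_add_right matrix_vector_mult_add_rdistrib scaleR_matrix_vector_assoc[symmetric])

subsection \<open>Support functions\<close>

lemma inner_le_support_fun: "\<theta> \<in> A \<Longrightarrow> ereal (inner z \<theta>) \<le> support_fun A z"
  unfolding support_fun_def by (rule SUP_upper)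

lemma support_fun_nonneg: "0 \<in> A \<Longrightarrow> 0 \<le> support_fun A z"
  using inner_le_support_fun[of 0 A z] by (simp add: zero_ereal_def)

lemma support_fun_zero: "A \<noteq> {} \<Longrightarrow> support_fun A 0 = 0"
  by (simp add: support_fun_def zero_ereal_def)

lemma support_fun_add_le:
  assumes "0 \<in> A"
  shows "support_fun A (u + v) \<le> support_fun A u + support_fun A v"
  unfolding support_fun_def[of A "u + v"]
proof (rule SUP_least)
  fix \<theta> assume "\<theta> \<in> A"
  then show "ereal (inner (u + v) \<theta>) \<le> support_fun A u + support_fun A v"
    unfolding inner_add_left plus_ereal.simps(1)[symmetric]
    by (intro add_mono inner_le_support_fun)
qed

lemma support_fun_scaleR_le:
  assumes "0 \<le> r"
  shows "support_fun A (r *\<^sub>R u) \<le> ereal r * support_fun A u"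
  unfolding support_fun_def[of A "r *\<^sub>R u"]
proof (rule SUP_least)
  fix \<theta> assume "\<theta> \<in> A"
  then have "ereal r * ereal (inner u \<theta>) \<le> ereal r * support_fun A u"
    using assms by (intro ereal_mult_left_mono inner_le_support_fun) auto
  then show "ereal (inner (r *\<^sub>R u) \<theta>) \<le> ereal r * support_fun A u"
    by simp
qed

lemma support_fun_mult_norm_le:
  assumes "cball 0 r \<subseteq> A" "0 \<le> r"
  shows "ereal (r * norm z) \<le> support_fun A z"
proof -
  \<comment> \<open>The test vector has length \<open>r\<close> and points along \<open>z\<close>.
    For \<open>z = 0\<close> division by zero makes it 0, which lies in the ball too.\<close>
  have "(r / norm z) *\<^sub>R z \<in> A"
    using assms by (auto simp: divide_simps)
  from inner_le_support_fun[OF this, of z] show ?thesis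
    by (cases "z = 0") (auto simp: dot_square_norm power2_eq_square)
qed

text \<open>Sublevel sets are intersections of closed half spaces, and the ball inside
  \<open>A\<close> forces growth of at least \<open>r * norm z\<close>, so they are bounded.\<close>

lemma good_rate_function_support_fun:
  fixes A :: "'a::euclidean_space set"
  assumes "cball 0 r \<subseteq> A" "0 < r"
  shows "good_rate_function (support_fun A)"
proof -
  have cl: "closed {z. support_fun A z \<le> ereal a}" for a
  proof -
    have "{z. support_fun A z \<le> ereal a} = (\<Inter>\<theta>\<in>A. {z. inner \<theta> z \<le> a})"
      by (auto simp: support_fun_def SUP_le_iff inner_commute)
    then show ?thesis
      by (auto intro: closed_halfspace_le)
  qed
  moreover have "bounded {z. support_fun A z \<le> ereal a}" for a
  proof (rule boundedI[of _ "a / r"])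
    fix z assume "z \<in> {z. support_fun A z \<le> ereal a}"
    then have "ereal (r * norm z) \<le> ereal a"
      using order_trans[OF support_fun_mult_norm_le[OF assms(1), of z], of "ereal a"] assms(2) by simp
    then show "norm z \<le> a / r"
      using assms(2) by (simp add: field_simps)
  qed
  moreover have "0 \<in> A"
    using assms by auto
  ultimately show ?thesis
    unfolding good_rate_function_def by (auto simp: support_fun_nonneg compact_eq_bounded_closed)
qed

section \<open>Convex duality and covering by half spaces\<close>

text \<open>A point outside a closed convex set is strictly separated from it, and the negated
  normal of the separating hyperplane violates the inequality.\<close>

lemma mem_closure_if_le_support_fun:
  fixes A :: "'a::euclidean_space set"
  assumes "convex A" "A \<noteq> {}" and le: "\<And>w. ereal (inner \<theta> w) \<le> support_fun A w"
  shows "\<theta> \<in> closure A"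
proof (rule ccontr)
  assume "\<theta> \<notin> closure A"
  then obtain a b where ab: "inner a \<theta> < b" "\<And>x. x \<in> closure A \<Longrightarrow> b < inner a x"
    using separating_hyperplane_closed_point[of "closure A" \<theta>] assms(1) by auto
  have "support_fun A (- a) \<le> ereal (- b)"
    unfolding support_fun_def using ab(2) closure_subset[of A]
    by (intro SUP_least) (auto intro: less_imp_le)
  then have "ereal (inner \<theta> (- a)) \<le> ereal (- b)"
    using le[of "- a"] by (rule order_trans[rotated])
  then show False
    using ab(1) by (simp add: inner_commute)
qed

lemma scaleR_closure_mem:
  fixes A :: "'a::euclidean_space set"
  assumes "convex A" "cball 0 r \<subseteq> A" "0 < r" "\<theta> \<in> closure A" "0 \<le> t" "t < 1"
  shows "t *\<^sub>R \<theta> \<in> A"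
proof -
  have "0 < (1 - t) * r"
    using assms by simp
  then obtain \<theta>' where \<theta>': "\<theta>' \<in> A" "dist \<theta>' \<theta> < (1 - t) * r"
    using assms(4) closure_approachable by blast
  \<comment> \<open>\<open>\<eta>\<close> solves \<open>t *\<^sub>R \<theta> = t *\<^sub>R \<theta>'
    + (1 - t) *\<^sub>R \<eta>\<close>. The distance \<open>(1 - t) * r\<close> allowed for
    \<open>\<theta>'\<close> makes its norm at most \<open>t * r\<close>.\<close>
  define \<eta> where "\<eta> = (t / (1 - t)) *\<^sub>R (\<theta> - \<theta>')"
  have "norm \<eta> = t / (1 - t) * dist \<theta>' \<theta>"
    using assms by (simp add: \<eta>_def dist_norm norm_minus_commute)
  also have "\<dots> \<le> t / (1 - t) * ((1 - t) * r)"
    using \<theta>' assms by (intro mult_left_mono) auto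
  also have "\<dots> \<le> r"
    using assms by (simp add: mult_left_le_one_le)
  finally have "\<eta> \<in> A"
    using assms(2) by auto
  then have "t *\<^sub>R \<theta>' + (1 - t) *\<^sub>R \<eta> \<in> A"
    using \<theta>' assms by (intro convexD) auto
  also have "t *\<^sub>R \<theta>' + (1 - t) *\<^sub>R \<eta> = t *\<^sub>R \<theta>"
    using assms by (simp add: \<eta>_def scaleR_diff_right)
  finally show ?thesis .
qed

text \<open>\<open>F\<close> may be unbounded. Half spaces with normals along the positive and
  negative axes first remove everything outside a box; compactness covers the rest.\<close>

lemma finite_halfspace_cover:
  fixes F :: "'a::euclidean_space set"
  assumes "closed F" and ball: "cball 0 r \<subseteq> L" "0 < r"
    and cover: "\<And>z. z \<in> F \<Longrightarrow> \<exists>l\<in>L. c < inner l z"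
  obtains S where "finite S" "S \<subseteq> L" "F \<subseteq> (\<Union>l\<in>S. {z. c < inner l z})"
proof -
  define S0 where "S0 = (\<lambda>b. r *\<^sub>R b) ` Basis \<union> (\<lambda>b::'a. (- r) *\<^sub>R b) ` Basis"
  define F' where "F' = F - (\<Union>l\<in>S0. {z. c < inner l z})"
  have S0: "finite S0" "S0 \<subseteq> L"
    using ball by (auto simp: S0_def)
  have "closed F'"
    unfolding F'_def using assms(1) by (intro closed_Diff open_UN ballI open_halfspace_gt)
  moreover have "bounded F'"
  proof (rule boundedI)
    fix z assume z: "z \<in> F'"
    have "\<bar>inner z b\<bar> \<le> c / r" if "b \<in> Basis" for b
    proof -
      have "inner (r *\<^sub>R b) z \<le> c" "inner ((- r) *\<^sub>R b) z \<le> c"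
        using z that by (auto simp: F'_def S0_def not_less)
      then show ?thesis
        using ball(2) by (auto simp: field_simps inner_commute abs_le_iff)
    qed
    then have "(\<Sum>b\<in>Basis. \<bar>inner z b\<bar>) \<le> (\<Sum>b\<in>(Basis::'a set). c / r)"
      by (rule sum_mono)
    then show "norm z \<le> (\<Sum>b\<in>(Basis::'a set). c / r)"
      using norm_le_l1[of z] by linarith
  qed
  ultimately have "compact F'"
    by (simp add: compact_eq_bounded_closed)
  moreover have "F' \<subseteq> (\<Union>l\<in>L. {z. c < inner l z})"
    using cover by (auto simp: F'_def)
  ultimately obtain S1 where S1: "S1 \<subseteq> L" "finite S1" "F' \<subseteq> (\<Union>l\<in>S1. {z. c < inner l z})"
    by (elim compactE_image[of F' L "\<lambda>l. {z. c < inner l z}"]) (auto intro: open_halfspace_gt)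
  show ?thesis
    by (rule that[of "S0 \<union> S1"]) (use S0 S1 in \<open>auto simp: F'_def\<close>)
qed

text \<open>The duality that feeds the lower bound: a bound on the dual side yields points of
  bounded total cost near \<open>z\<close>. Separation reaches only the closure of an epigraph,
  hence the error \<open>e\<close> in both place and cost.\<close>

lemma support_fun_INT_approx:
  fixes A :: "(real^'d) set" and Y :: "(real^'d^'m) set" and z :: "real^'m"
  assumes A: "convex A" "cball 0 r \<subseteq> A" "0 < r"
    and le: "support_fun {l. \<forall>y\<in>Y. l v* y \<in> A} z \<le> ereal c" and "0 < e"
  obtains F w where "finite F" "F \<subseteq> Y" "norm ((\<Sum>y\<in>F. y *v w y) - z) < e"
    "(\<Sum>y\<in>F. support_fun A (w y)) \<le> ereal (c + e)"
proof -
  interpret v: bounded_bilinear "(v*) :: real^'m \<Rightarrow> real^'d^'m \<Rightarrow> real^'d"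
    by (rule bounded_bilinear_vector_matrix_mult)
  interpret m: bounded_bilinear "(*v) :: real^'d^'m \<Rightarrow> real^'d \<Rightarrow> real^'m"
    by (rule bounded_bilinear_matrix_vector_mult)
  \<comment> \<open>\<open>E\<close> is a convex cone: the epigraph of the infimal cost of representing a point as
    \<open>\<Sum>y\<in>F. y *v w y\<close>.  The claim is that \<open>(z, c)\<close> lies in its closure.\<close>
  define E where "E = {(\<Sum>y\<in>F. y *v w y, s) | F w s. finite F \<and> F \<subseteq> Y \<and>
      (\<forall>y. y \<notin> F \<longrightarrow> w y = 0) \<and> (\<Sum>y\<in>F. support_fun A (w y)) \<le> ereal s}"
  have A0: "0 \<in> A" "A \<noteq> {}"
    using A by auto
  have E_add: "p + q \<in> E" if "p \<in> E" "q \<in> E" for p q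
  proof -
    from that obtain F w s F' w' s' where
      p: "p = (\<Sum>y\<in>F. y *v w y, s)" "finite F" "F \<subseteq> Y" "\<forall>y. y \<notin> F \<longrightarrow> w y = 0"
        "(\<Sum>y\<in>F. support_fun A (w y)) \<le> ereal s" and
      q: "q = (\<Sum>y\<in>F'. y *v w' y, s')" "finite F'" "F' \<subseteq> Y" "\<forall>y. y \<notin> F' \<longrightarrow> w' y = 0"
        "(\<Sum>y\<in>F'. support_fun A (w' y)) \<le> ereal s'"
      unfolding E_def by auto
    let ?G = "F \<union> F'"
    \<comment> \<open>The weights vanish off their index sets and
      \<open>support_fun A 0 = 0\<close>, so all four sums extend to the union.\<close>
    have 1: "(\<Sum>y\<in>F. y *v w y) = (\<Sum>y\<in>?G. y *v w y)"
      "(\<Sum>y\<in>F'. y *v w' y) = (\<Sum>y\<in>?G. y *v w' y)"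
      "(\<Sum>y\<in>F. support_fun A (w y)) = (\<Sum>y\<in>?G. support_fun A (w y))"
      "(\<Sum>y\<in>F'. support_fun A (w' y)) = (\<Sum>y\<in>?G. support_fun A (w' y))"
      using p q by (auto intro!: sum.mono_neutral_left simp: m.zero_right support_fun_zero[OF A0(2)])
    have "(\<Sum>y\<in>?G. support_fun A (w y + w' y)) \<le>
        (\<Sum>y\<in>?G. support_fun A (w y) + support_fun A (w' y))"
      using A0 by (intro sum_mono support_fun_add_le)
    also have "\<dots> \<le> ereal (s + s')"
      using p(5) q(5) unfolding 1 sum.distrib plus_ereal.simps(1)[symmetric] by (rule add_mono)
    finally show ?thesis
      unfolding E_def using p q
      by (auto intro!: exI[of _ ?G] exI[of _ "\<lambda>y. w y + w' y"] exI[of _ "s + s'"]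
          simp: 1 m.add_right sum.distrib)
  qed
  have E_scale: "k *\<^sub>R p \<in> E" if "p \<in> E" "0 \<le> k" for p k
  proof -
    from that obtain F w s where
      p: "p = (\<Sum>y\<in>F. y *v w y, s)" "finite F" "F \<subseteq> Y" "\<forall>y. y \<notin> F \<longrightarrow> w y = 0"
        "(\<Sum>y\<in>F. support_fun A (w y)) \<le> ereal s"
      unfolding E_def by auto
    have "(\<Sum>y\<in>F. support_fun A (k *\<^sub>R w y)) \<le> (\<Sum>y\<in>F. ereal k * support_fun A (w y))"
      using that by (intro sum_mono support_fun_scaleR_le)
    also have "\<dots> = ereal k * (\<Sum>y\<in>F. support_fun A (w y))"
      using A0 by (intro sum_ereal_right_distrib[symmetric] support_fun_nonneg)
    also have "\<dots> \<le> ereal k * ereal s"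
      using p that by (intro ereal_mult_left_mono) auto
    finally show ?thesis
      unfolding E_def using p
      by (auto intro!: exI[of _ F] exI[of _ "\<lambda>y. k *\<^sub>R w y"] exI[of _ "k * s"]
          simp: m.scaleR_right scaleR_sum_right)
  qed
  have "convex E"
    unfolding convex_def by (auto intro: E_add E_scale)
  have E_vert: "(0, s) \<in> E" if "0 \<le> s" for s
    unfolding E_def using that by (auto intro!: exI[of _ "{}"] exI[of _ "\<lambda>_. 0"] simp: zero_ereal_def)
  have E_single: "(y *v u, s) \<in> E" if "y \<in> Y" "support_fun A u \<le> ereal s" for y u s
    unfolding E_def using that
    by (auto intro!: exI[of _ "{y}"] exI[of _ "\<lambda>y'. if y' = y then u else 0"] exI[of _ s]
        split: if_splits)
  have E_nonneg: "0 \<le> s" if "(u, s) \<in> E" for u s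
  proof -
    from that obtain F :: "(real^'d^'m) set" and w where "(\<Sum>y\<in>F. support_fun A (w y)) \<le> ereal s"
      unfolding E_def by auto
    moreover have "0 \<le> (\<Sum>y\<in>F. support_fun A (w y))"
      using A0 by (intro sum_nonneg support_fun_nonneg)
    ultimately show ?thesis
      by (metis ereal_less_eq(5) order_trans)
  qed
  have "(z, c) \<in> closure E"
  proof (rule ccontr)
    assume "(z, c) \<notin> closure E"
    then obtain ab \<beta> where ab: "inner ab (z, c) < \<beta>" "\<And>p. p \<in> closure E \<Longrightarrow> \<beta> < inner ab p"
      using separating_hyperplane_closed_point[of "closure E" "(z, c)"] convex_closure[OF \<open>convex E\<close>]
      by (metis closed_closure)
    obtain a b where [simp]: "ab = (a, b)"
      by force
    have sep: "inner a z + b * c < 0"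
      using ab(1) ab(2)[of 0] E_vert[of 0] closure_subset[of E] by (auto simp: zero_prod_def)
    \<comment> \<open>On a cone, a functional bounded below is nonnegative: a negative value could
      be rescaled to \<open>- \<bar>\<beta>\<bar>\<close>, which is not above
      \<open>\<beta>\<close>.\<close>
    have pos: "0 \<le> inner a u + b * s" if "(u, s) \<in> E" for u s
    proof (rule ccontr)
      assume neg: "\<not> ?thesis"
      define k where "k = - \<bar>\<beta>\<bar> / (inner a u + b * s)"
      have "0 \<le> k"
        using neg by (auto simp: k_def intro: divide_nonneg_neg)
      have "k *\<^sub>R (u, s) \<in> closure E"
        using E_scale[OF that, of k] \<open>0 \<le> k\<close> closure_subset by auto
      then have "\<beta> < k * (inner a u + b * s)"
        using ab(2) by (fastforce simp: algebra_simps)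
      also have "\<dots> = - \<bar>\<beta>\<bar>"
        using neg by (simp add: k_def)
      finally show False by simp
    qed
    have "0 \<le> b"
      using pos[of 0 1] E_vert[of 1] by simp
    \<comment> \<open>Tilting the hyperplane slightly keeps it separating, as \<open>s \<ge> 0\<close> on \<open>E\<close>, and makes it non-vertical.\<close>
    obtain b' where b': "b < b'" "inner a z + b' * c < 0"
    proof (rule that)
      define \<delta> where "\<delta> = - (inner a z + b * c) / (2 * (\<bar>c\<bar> + 1))"
      have "0 < \<delta>"
        unfolding \<delta>_def using sep by (intro divide_pos_pos) auto
      then show "b < b + \<delta>"
        by simp
      have "\<delta> * c \<le> \<delta> * (\<bar>c\<bar> + 1)"
        using \<open>0 < \<delta>\<close> by (intro mult_left_mono) auto
      also have "\<dots> = - (inner a z + b * c) / 2"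
        unfolding \<delta>_def using abs_ge_zero[of c] by (simp add: field_simps del: abs_ge_zero)
      finally show "inner a z + (b + \<delta>) * c < 0"
        using sep by (simp add: algebra_simps)
    qed
    have "0 < b'"
      using b' \<open>0 \<le> b\<close> by simp
    \<comment> \<open>As \<open>b'\<close> is positive, the tilted hyperplane is the graph of a
      linear map. Its slope \<open>l\<close> keeps the graph below \<open>E\<close>, while its value
      at \<open>z\<close> exceeds \<open>c\<close>.\<close>
    define l where "l = - (1 / b') *\<^sub>R a"
    have l_le: "inner l u \<le> s" if "(u, s) \<in> E" for u s
    proof -
      have "b * s \<le> b' * s"
        using b' E_nonneg[OF that] by (intro mult_right_mono) auto
      then have "0 \<le> inner a u + b' * s"
        using pos[OF that] by simp
      then show ?thesis
        using \<open>0 < b'\<close> by (simp add: l_def field_simps)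
    qed
    have l_z: "c < inner l z"
      using b' \<open>0 < b'\<close> by (simp add: l_def field_simps)
    \<comment> \<open>One-point representations in \<open>E\<close> turn \<open>l_le\<close> into
      the comparison with the support function of \<open>A\<close> that characterises its
      closure.\<close>
    have l_cl: "l v* y \<in> closure A" if "y \<in> Y" for y
    proof (rule mem_closure_if_le_support_fun)
      fix u
      have nn: "0 \<le> support_fun A u"
        using A0 by (intro support_fun_nonneg)
      show "ereal (inner (l v* y) u) \<le> support_fun A u"
      proof (cases "support_fun A u")
        case (real s)
        then show ?thesis
          using l_le[OF E_single[OF that, of u s]] by (simp add: dot_lmul_matrix)
      qed (use nn in auto)
    qed (use A A0 in auto)
    \<comment> \<open>Only the closure of \<open>A\<close> has been reached. Shrinking by
      \<open>t < 1\<close> returns to \<open>A\<close>, where \<open>le\<close> applies; then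
      \<open>t\<close> tends to 1.\<close>
    have l_t: "t * inner l z \<le> c" if t: "t < 1" "0 < t" for t
    proof -
      have "t *\<^sub>R l \<in> {l. \<forall>y\<in>Y. l v* y \<in> A}"
        using scaleR_closure_mem[OF A l_cl] t by (auto simp: v.scaleR_left)
      from order_trans[OF inner_le_support_fun[OF this, of z] le] show ?thesis
        by (simp add: inner_commute)
    qed
    have "((\<lambda>t. t * inner l z) \<longlongrightarrow> 1 * inner l z) (at_left 1)"
      by (intro tendsto_intros)
    moreover have "\<forall>\<^sub>F t in at_left 1. t * inner l z \<le> c"
      using eventually_at_left_real[OF zero_less_one] by eventually_elim (use l_t in auto)
    ultimately have "1 * inner l z \<le> c"
      by (intro tendsto_upperbound) auto
    then show False
      using l_z by simp
  qed
  then obtain p where p: "p \<in> E" "dist p (z, c) < e"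
    using \<open>0 < e\<close> closure_approachable by blast
  obtain u s where us: "p = (u, s)"
    by force
  have d: "dist u z < e" "\<bar>s - c\<bar> < e"
    using p(2) dist_fst_le[of p "(z, c)"] dist_snd_le[of p "(z, c)"] us by (auto simp: dist_real_def)
  from p us obtain F w where F: "u = (\<Sum>y\<in>F. y *v w y)" "finite F" "F \<subseteq> Y"
      "(\<Sum>y\<in>F. support_fun A (w y)) \<le> ereal s"
    unfolding E_def by auto
  moreover have "ereal s \<le> ereal (c + e)"
    using d by simp
  ultimately show ?thesis
    using d by (intro that[of F w]) (auto simp: dist_norm intro: order_trans)
qed

subsection \<open>Exponential rates\<close>

text \<open>After taking logarithms and dividing by \<open>n\<close>, the factors \<open>N\<close>
  and \<open>B ^ k n\<close> vanish because \<open>k n / n\<close> tends to 0; only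
  \<open>- c\<close> remains.\<close>

lemma limsup_eln_le:
  fixes p :: "nat \<Rightarrow> real" and k :: "nat \<Rightarrow> nat"
  assumes k: "(\<lambda>n. real (k n) / real n) \<longlonglongrightarrow> 0" and "0 < N" "0 < B"
    and le: "\<forall>\<^sub>F n in sequentially. p n \<le> N * exp (- (real n * c)) * B ^ k n"
  shows "limsup (\<lambda>n. ereal (1 / real n) * eln (p n)) \<le> ereal (- c)"
proof -
  let ?r = "\<lambda>n. ln N * (1 / real n) - c + real (k n) / real n * ln B"
  have "?r \<longlonglongrightarrow> ln N * 0 - c + 0 * ln B"
    by (intro tendsto_intros k lim_1_over_n)
  then have lim: "limsup (\<lambda>n. ereal (?r n)) = ereal (- c)"
    by (intro lim_imp_Limsup) (auto intro!: tendsto_ereal)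
  \<comment> \<open>For \<open>n > 0\<close> a nonpositive \<open>p n\<close> gives -\<infinity>. At
    \<open>n = 0\<close> the coefficient \<open>1 / real n\<close> is 0 and so is the product, so
    that index is dropped.\<close>
  have "\<forall>\<^sub>F n in sequentially. ereal (1 / real n) * eln (p n) \<le> ereal (?r n)"
    using le eventually_gt_at_top[of 0]
  proof eventually_elim
    case (elim n)
    show ?case
    proof (cases "p n \<le> 0")
      case False
      have "ln (p n) \<le> ln (N * exp (- (real n * c)) * B ^ k n)"
        using False elim by (subst ln_le_cancel_iff) auto
      also have "\<dots> = ln N - real n * c + real (k n) * ln B"
        using assms by (simp add: ln_mult ln_realpow)
      finally have "1 / real n * ln (p n) \<le> 1 / real n * (ln N - real n * c + real (k n) * ln B)"
        by (intro mult_left_mono) auto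
      also have "\<dots> = ?r n"
        using elim by (simp add: field_simps)
      finally show ?thesis
        using False by (simp add: eln_def)
    qed (use elim in \<open>auto simp: eln_def\<close>)
  qed
  from Limsup_mono[OF this] lim show ?thesis
    by simp
qed

lemma liminf_eln_ge:
  fixes p :: "nat \<Rightarrow> real" and k :: "nat \<Rightarrow> nat"
  assumes k: "(\<lambda>n. real (k n) / real n) \<longlonglongrightarrow> 0" and "0 < q"
    and ge: "\<forall>\<^sub>F n in sequentially. exp (- (real n * c)) * q ^ k n \<le> p n"
  shows "ereal (- c) \<le> liminf (\<lambda>n. ereal (1 / real n) * eln (p n))"
proof -
  let ?r = "\<lambda>n. - c + real (k n) / real n * ln q"
  have "?r \<longlonglongrightarrow> - c + 0 * ln q"
    by (intro tendsto_intros k)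
  then have lim: "liminf (\<lambda>n. ereal (?r n)) = ereal (- c)"
    by (intro lim_imp_Liminf) (auto intro!: tendsto_ereal)
  have "\<forall>\<^sub>F n in sequentially. ereal (?r n) \<le> ereal (1 / real n) * eln (p n)"
    using ge eventually_gt_at_top[of 0]
  proof eventually_elim
    case (elim n)
    have pos: "0 < exp (- (real n * c)) * q ^ k n"
      using assms by simp
    then have "0 < p n"
      using elim by linarith
    have "ln (exp (- (real n * c)) * q ^ k n) \<le> ln (p n)"
      using pos \<open>0 < p n\<close> elim by (subst ln_le_cancel_iff) auto
    also have "ln (exp (- (real n * c)) * q ^ k n) = - (real n * c) + real (k n) * ln q"
      using assms by (simp add: ln_mult ln_realpow)
    finally have "1 / real n * (- (real n * c) + real (k n) * ln q) \<le> 1 / real n * ln (p n)"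
      by (intro mult_left_mono) auto
    also have "1 / real n * (- (real n * c) + real (k n) * ln q) = ?r n"
      using elim by (simp add: field_simps)
    finally show ?case
      using \<open>0 < p n\<close> by (simp add: eln_def)
  qed
  from Liminf_mono[OF this] lim show ?thesis
    by simp
qed

text \<open>By strictness the terms themselves eventually exceed \<open>- c\<close>. This rules out
  \<open>eln (p n) = -\<infinity>\<close>, so \<open>p n\<close> is positive and the logarithm can
  be undone.\<close>

lemma eventually_ge_if_less_liminf_eln:
  fixes p :: "nat \<Rightarrow> real"
  assumes "ereal (- c) < liminf (\<lambda>n. ereal (1 / real n) * eln (p n))"
  shows "\<forall>\<^sub>F n in sequentially. exp (- (real n * c)) \<le> p n"
  using less_LiminfD[OF assms] eventually_gt_at_top[of 0]
proof eventually_elim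
  case (elim n)
  then have "0 < p n"
    by (auto simp: eln_def split: if_splits)
  then have "- c < 1 / real n * ln (p n)"
    using elim by (simp add: eln_def)
  then have "- (real n * c) \<le> ln (p n)"
    using elim by (simp add: field_simps)
  then show ?case
    using \<open>0 < p n\<close> by (metis exp_le_cancel_iff exp_ln)
qed

subsection \<open>Limits of sets\<close>

lemma outer_limit_subset:
  fixes K :: "'a::t2_space set"
  assumes "compact K" "\<And>n. 1 \<le> n \<Longrightarrow> D n \<subseteq> K"
  shows "outer_limit D \<subseteq> K"
proof
  fix y assume "y \<in> outer_limit D"
  then obtain \<phi> xs where xs: "strict_mono \<phi>" "\<And>n. xs n \<in> D (\<phi> n)" "xs \<longlonglongrightarrow> y"
    unfolding outer_limit_def by auto
  have "\<forall>\<^sub>F n in sequentially. xs n \<in> K"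
    using eventually_ge_at_top[of 1]
  proof eventually_elim
    case (elim n)
    \<comment> \<open>The inclusion in \<open>K\<close> starts at index 1; strict monotonicity gives
      \<open>n \<le> \<phi> n\<close>.\<close>
    then have "1 \<le> \<phi> n"
      using seq_suble[OF xs(1), of n] by linarith
    then show ?case
      using assms(2) xs(2) by blast
  qed
  then show "y \<in> K"
    using compact_imp_closed[OF assms(1)] xs(3) by (intro Lim_in_closed_set) auto
qed

text \<open>Otherwise there are points \<open>u k\<close> of \<open>D (\<phi> k)\<close> where
  \<open>h\<close> exceeds \<open>k\<close>. By compactness a subsequence converges, its limit lies
  in the outer limit, and the local bound there is violated.\<close>

lemma eventually_bounded_if_locally_bounded_outer_limit:
  fixes h :: "'a::metric_space \<Rightarrow> ennreal"
  assumes K: "compact K" "\<And>n. 1 \<le> n \<Longrightarrow> D n \<subseteq> K"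
    and h: "\<And>y. y \<in> outer_limit D \<Longrightarrow> \<exists>B::real. \<forall>\<^sub>F u in nhds y. h u \<le> ennreal B"
  obtains B :: real where "\<forall>\<^sub>F n in sequentially. \<forall>u\<in>D n. h u \<le> ennreal B"
proof (rule ccontr)
  assume "\<not> thesis"
  then have "\<not> (\<forall>\<^sub>F n in sequentially. \<forall>u\<in>D n. h u \<le> ennreal B)" for B :: real
    using that by blast
  then have unb: "\<exists>n\<ge>N. \<exists>u\<in>D n. \<not> h u \<le> ennreal B" for N :: nat and B :: real
    unfolding eventually_sequentially by blast
  \<comment> \<open>Each index is chosen beyond the previous one, since the outer limit asks for a
    strictly increasing \<open>\<phi>\<close>.\<close>
  have "\<exists>\<phi>. \<forall>k. (1 \<le> \<phi> k \<and> (\<exists>u\<in>D (\<phi> k). \<not> h u \<le> ennreal (real k))) \<and> \<phi> k < \<phi> (Suc k)"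
  proof (rule dependent_nat_choice)
    show "\<exists>n. 1 \<le> n \<and> (\<exists>u\<in>D n. \<not> h u \<le> ennreal (real 0))"
      using unb[of 1 "real 0"] by blast
    show "\<exists>m. (1 \<le> m \<and> (\<exists>u\<in>D m. \<not> h u \<le> ennreal (real (Suc k)))) \<and> n < m"
      if "1 \<le> n \<and> (\<exists>u\<in>D n. \<not> h u \<le> ennreal (real k))" for n k
    proof -
      obtain m where "Suc n \<le> m" "\<exists>u\<in>D m. \<not> h u \<le> ennreal (real (Suc k))"
        using unb by blast
      then show ?thesis
        by (intro exI[of _ m]) auto
    qed
  qed
  then obtain \<phi> where \<phi>: "\<And>k. 1 \<le> \<phi> k" "\<And>k. \<exists>u\<in>D (\<phi> k). \<not> h u \<le> ennreal (real k)"
      "strict_mono \<phi>"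
    by (auto simp: strict_mono_Suc_iff)
  then obtain u where u: "\<And>k. u k \<in> D (\<phi> k)" "\<And>k. \<not> h (u k) \<le> ennreal (real k)"
    by metis
  have "u k \<in> K" for k
    using u(1) K(2) \<phi>(1) by blast
  then obtain y \<psi> where \<psi>: "strict_mono \<psi>" "(u \<circ> \<psi>) \<longlonglongrightarrow> y"
    using K(1) unfolding compact_eq_seq_compact_metric seq_compact_def by metis
  then have "y \<in> outer_limit D"
    unfolding outer_limit_def using u(1) strict_mono_o[OF \<phi>(3) \<psi>(1)]
    by (auto intro!: exI[of _ "\<phi> \<circ> \<psi>"] exI[of _ "u \<circ> \<psi>"])
  then obtain B :: real where "\<forall>\<^sub>F v in nhds y. h v \<le> ennreal B"
    using h by blast
  then have "\<forall>\<^sub>F k in sequentially. h ((u \<circ> \<psi>) k) \<le> ennreal B"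
    using \<psi>(2) by (auto simp: filterlim_iff)
  \<comment> \<open>From here on \<open>B\<close> is at most \<open>\<psi> k\<close>, the level that
    \<open>h (u (\<psi> k))\<close> exceeds.\<close>
  moreover have "\<forall>\<^sub>F k in sequentially. nat \<lceil>B\<rceil> \<le> k"
    by (rule eventually_ge_at_top)
  ultimately have "\<forall>\<^sub>F k in sequentially. False"
  proof eventually_elim
    case (elim k)
    have "B \<le> real (\<psi> k)"
      using elim(2) seq_suble[OF \<psi>(1), of k] by linarith
    then have "h (u (\<psi> k)) \<le> ennreal (real (\<psi> k))"
      using elim(1) by (auto intro: order_trans ennreal_leI)
    then show ?case
      using u(2) by blast
  qed
  then show False
    by simp
qed

subsection \<open>Moment generating functions\<close>

lemma nn_integral_exp_convex_le:
  fixes Z :: "'b \<Rightarrow> 'c::euclidean_space"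
  assumes [measurable]: "Z \<in> borel_measurable M" and t: "0 \<le> t" "t \<le> 1"
  shows "(\<integral>\<^sup>+\<omega>. ennreal (exp (inner (t *\<^sub>R \<theta> + (1 - t) *\<^sub>R \<eta>) (Z \<omega>))) \<partial>M) \<le>
    ennreal t * (\<integral>\<^sup>+\<omega>. ennreal (exp (inner \<theta> (Z \<omega>))) \<partial>M) +
    ennreal (1 - t) * (\<integral>\<^sup>+\<omega>. ennreal (exp (inner \<eta> (Z \<omega>))) \<partial>M)"
proof -
  have "exp (inner (t *\<^sub>R \<theta> + (1 - t) *\<^sub>R \<eta>) z) \<le> t * exp (inner \<theta> z) + (1 - t) * exp (inner \<eta> z)" for z
    using convex_onD[OF exp_convex, of "1 - t" "inner \<theta> z" "inner \<eta> z"] t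
    by (simp add: inner_add_left)
  then have "(\<integral>\<^sup>+\<omega>. ennreal (exp (inner (t *\<^sub>R \<theta> + (1 - t) *\<^sub>R \<eta>) (Z \<omega>))) \<partial>M) \<le>
      (\<integral>\<^sup>+\<omega>. ennreal t * ennreal (exp (inner \<theta> (Z \<omega>))) +
         ennreal (1 - t) * ennreal (exp (inner \<eta> (Z \<omega>))) \<partial>M)"
    using t by (intro nn_integral_mono)
      (simp flip: ennreal_mult' ennreal_plus add: ennreal_leI)
  also have "\<dots> = ennreal t * (\<integral>\<^sup>+\<omega>. ennreal (exp (inner \<theta> (Z \<omega>))) \<partial>M) +
    ennreal (1 - t) * (\<integral>\<^sup>+\<omega>. ennreal (exp (inner \<eta> (Z \<omega>))) \<partial>M)"
    by (simp add: nn_integral_add nn_integral_cmult)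
  finally show ?thesis .
qed

lemma convex_mgf_domain:
  fixes Z :: "'b \<Rightarrow> 'c::euclidean_space"
  assumes "Z \<in> borel_measurable M"
  shows "convex (mgf_domain M Z)"
  unfolding convex_alt
proof (intro ballI allI impI)
  fix \<eta> \<theta> and t :: real
  assume *: "\<eta> \<in> mgf_domain M Z" "\<theta> \<in> mgf_domain M Z" and t: "0 \<le> t \<and> t \<le> 1"
  have "(\<integral>\<^sup>+\<omega>. ennreal (exp (inner (t *\<^sub>R \<theta> + (1 - t) *\<^sub>R \<eta>) (Z \<omega>))) \<partial>M) < \<infinity>"
    using * t by (intro le_less_trans[OF nn_integral_exp_convex_le[OF assms]])
      (auto simp: mgf_domain_def ennreal_mult_less_top)
  then show "(1 - t) *\<^sub>R \<eta> + t *\<^sub>R \<theta> \<in> mgf_domain M Z"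
    by (simp add: mgf_domain_def add.commute)
qed

lemma nn_integral_exp_inner_le_norm:
  assumes "norm \<theta> \<le> \<alpha>"
  shows "(\<integral>\<^sup>+\<omega>. ennreal (exp (inner \<theta> (Z \<omega>))) \<partial>M) \<le>
    (\<integral>\<^sup>+\<omega>. ennreal (exp (\<alpha> * norm (Z \<omega>))) \<partial>M)"
proof (intro nn_integral_mono ennreal_leI)
  fix \<omega>
  have "inner \<theta> (Z \<omega>) \<le> norm \<theta> * norm (Z \<omega>)"
    by (rule norm_cauchy_schwarz)
  also have "\<dots> \<le> \<alpha> * norm (Z \<omega>)"
    using assms by (intro mult_right_mono) auto
  finally show "exp (inner \<theta> (Z \<omega>)) \<le> exp (\<alpha> * norm (Z \<omega>))"
    by simp
qed

lemma cball_subset_mgf_domain: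
  assumes "(\<integral>\<^sup>+\<omega>. ennreal (exp (\<alpha> * norm (Z \<omega>))) \<partial>M) < \<infinity>"
  shows "cball 0 \<alpha> \<subseteq> mgf_domain M Z"
  using le_less_trans[OF nn_integral_exp_inner_le_norm assms]
  by (auto simp: mgf_domain_def)

text \<open>\<open>\<theta>\<close> may be a boundary point of the domain. Points near
  \<open>t *\<^sub>R \<theta>\<close> are convex combinations of \<open>\<theta>\<close>, with
  weight \<open>t\<close>, and a vector of norm at most \<open>\<alpha>\<close>, so convexity bounds
  the integral by \<open>b\<close>.\<close>

lemma mgf_locally_bounded:
  fixes Z :: "'b \<Rightarrow> 'c::euclidean_space"
  assumes Z: "Z \<in> borel_measurable M"
    and \<alpha>: "0 < \<alpha>" "(\<integral>\<^sup>+\<omega>. ennreal (exp (\<alpha> * norm (Z \<omega>))) \<partial>M) < \<infinity>"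
    and "\<theta> \<in> mgf_domain M Z" "0 \<le> t" "t < 1"
  shows "\<exists>B::real. \<forall>\<^sub>F \<eta> in nhds (t *\<^sub>R \<theta>). (\<integral>\<^sup>+\<omega>. ennreal (exp (inner \<eta> (Z \<omega>))) \<partial>M) \<le> ennreal B"
proof -
  define b where "b = ennreal t * (\<integral>\<^sup>+\<omega>. ennreal (exp (inner \<theta> (Z \<omega>))) \<partial>M) +
      ennreal (1 - t) * (\<integral>\<^sup>+\<omega>. ennreal (exp (\<alpha> * norm (Z \<omega>))) \<partial>M)"
  have "b < \<infinity>"
    using assms by (auto simp: b_def mgf_domain_def ennreal_mult_less_top)
  then obtain B where B: "b = ennreal B"
    by (cases b) auto
  have "\<forall>\<^sub>F \<eta> in nhds (t *\<^sub>R \<theta>). dist \<eta> (t *\<^sub>R \<theta>) < (1 - t) * \<alpha>"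
    unfolding eventually_nhds_metric using assms by (intro exI[of _ "(1 - t) * \<alpha>"]) auto
  then have "\<forall>\<^sub>F \<eta> in nhds (t *\<^sub>R \<theta>). (\<integral>\<^sup>+\<omega>. ennreal (exp (inner \<eta> (Z \<omega>))) \<partial>M) \<le> ennreal B"
  proof eventually_elim
    case (elim \<eta>)
    define \<zeta> where "\<zeta> = (1 / (1 - t)) *\<^sub>R (\<eta> - t *\<^sub>R \<theta>)"
    have \<eta>: "\<eta> = t *\<^sub>R \<theta> + (1 - t) *\<^sub>R \<zeta>"
      using assms by (simp add: \<zeta>_def)
    have "norm \<zeta> = dist \<eta> (t *\<^sub>R \<theta>) / (1 - t)"
      using assms by (simp add: \<zeta>_def dist_norm)
    then have "norm \<zeta> \<le> \<alpha>"
      using elim assms by (simp add: pos_divide_le_eq mult.commute)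
    then have "ennreal t * (\<integral>\<^sup>+\<omega>. ennreal (exp (inner \<theta> (Z \<omega>))) \<partial>M) +
      ennreal (1 - t) * (\<integral>\<^sup>+\<omega>. ennreal (exp (inner \<zeta> (Z \<omega>))) \<partial>M) \<le> b"
      unfolding b_def by (intro add_mono mult_left_mono nn_integral_exp_inner_le_norm) auto
    then show ?case
      using nn_integral_exp_convex_le[OF Z, of t \<theta> \<zeta>] assms(5,6) unfolding \<eta> B by simp
  qed
  then show ?thesis ..
qed

lemma mat_mgf_domain_eq: "mat_mgf_domain M Z y = {l. l v* y \<in> mgf_domain M Z}"
  by (simp add: mat_mgf_domain_def mgf_domain_def dot_lmul_matrix)

text \<open>Chernoff's bound with exponent 1, any tilt being part of \<open>X\<close>: Markov's
  inequality for the exponential of the sum, which factorises by independence.\<close>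

lemma (in prob_space) prob_sum_ge_le:
  fixes X :: "'i \<Rightarrow> 'a \<Rightarrow> real"
  assumes I: "finite I" "indep_vars (\<lambda>_. borel) X I"
    and B: "\<And>i. i \<in> I \<Longrightarrow> (\<integral>\<^sup>+\<omega>. ennreal (exp (X i \<omega>)) \<partial>M) \<le> ennreal B" "0 \<le> B"
  shows "prob {\<omega>\<in>space M. a \<le> (\<Sum>i\<in>I. X i \<omega>)} \<le> exp (- a) * B ^ card I"
proof -
  have [measurable]: "\<And>i. i \<in> I \<Longrightarrow> X i \<in> borel_measurable M"
    using I by (auto simp: indep_vars_def)
  let ?S = "\<lambda>\<omega>. \<Sum>i\<in>I. X i \<omega>"
  have "emeasure M {\<omega>\<in>space M. a \<le> ?S \<omega>} =
      emeasure M {\<omega>\<in>space M. 1 \<le> ennreal (exp (- a)) * ennreal (exp (?S \<omega>))}"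
    by (simp flip: ennreal_mult' exp_add add: ennreal_1[symmetric] del: ennreal_1)
  also have "\<dots> \<le> ennreal (exp (- a)) * (\<integral>\<^sup>+\<omega>. ennreal (exp (?S \<omega>)) * indicator (space M) \<omega> \<partial>M)"
    by (rule nn_integral_Markov_inequality) auto
  also have "(\<integral>\<^sup>+\<omega>. ennreal (exp (?S \<omega>)) * indicator (space M) \<omega> \<partial>M) =
      (\<integral>\<^sup>+\<omega>. (\<Prod>i\<in>I. ennreal (exp (X i \<omega>))) \<partial>M)"
    by (intro nn_integral_cong) (simp add: exp_sum I prod_ennreal)
  also have "\<dots> = (\<Prod>i\<in>I. \<integral>\<^sup>+\<omega>. ennreal (exp (X i \<omega>)) \<partial>M)"
    using I by (intro indep_vars_nn_integral indep_vars_compose2[OF I(2)]) auto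
  also have "\<dots> \<le> (\<Prod>i\<in>I. ennreal B)"
    using B by (intro prod_mono_ennreal)
  also have "\<dots> = ennreal (B ^ card I)"
    using B by (simp add: ennreal_power)
  finally have "emeasure M {\<omega>\<in>space M. a \<le> ?S \<omega>} \<le> ennreal (exp (- a) * B ^ card I)"
    using B by (simp add: ennreal_mult mult_left_mono)
  then show ?thesis
    using B by (simp add: emeasure_eq_measure)
qed

subsection \<open>Weighted sums of i.i.d. vectors\<close>

text \<open>\<open>y n i\<close> stands for \<open>f (x n i)\<close>. Conditions start at
  \<open>n = 1\<close> because \<open>C 0\<close>, a subset of \<open>{1..0}\<close> in the
  application, is empty.\<close>

locale weighted_iid_sums = prob_space M for M :: "'a measure" +
  fixes Z :: "nat \<Rightarrow> 'a \<Rightarrow> real^'d" and y :: "nat \<Rightarrow> nat \<Rightarrow> real^'d^'m"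
    and C :: "nat \<Rightarrow> nat set" and \<alpha> :: real and K :: "(real^'d^'m) set"
  assumes indep: "indep_vars (\<lambda>_. borel) Z UNIV"
    and ident: "\<And>i. distr M borel (Z i) = distr M borel (Z 1)"
    and exp_moment: "0 < \<alpha>" "(\<integral>\<^sup>+\<omega>. ennreal (exp (\<alpha> * norm (Z 1 \<omega>))) \<partial>M) < \<infinity>"
    and finite_C: "\<And>n. finite (C n)"
    and nonempty_C: "\<And>n. 1 \<le> n \<Longrightarrow> C n \<noteq> {}"
    and card_C: "(\<lambda>n. real (card (C n)) / real n) \<longlonglongrightarrow> 0"
    and compact_K: "compact K"
    and y_in_K: "\<And>n. 1 \<le> n \<Longrightarrow> y n ` C n \<subseteq> K"
begin

sublocale v: bounded_bilinear "(v*) :: real^'m \<Rightarrow> real^'d^'m \<Rightarrow> real^'d"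
  by (rule bounded_bilinear_vector_matrix_mult)

sublocale m: bounded_bilinear "(*v) :: real^'d^'m \<Rightarrow> real^'d \<Rightarrow> real^'m"
  by (rule bounded_bilinear_matrix_vector_mult)

definition weighted_mean :: "nat \<Rightarrow> 'a \<Rightarrow> real^'m" where
  "weighted_mean n \<omega> = (1 / real n) *\<^sub>R (\<Sum>i\<in>C n. y n i *v Z i \<omega>)"

text \<open>This is the intersection of the sets \<open>mat_mgf_domain M (Z 1) u\<close> over
  \<open>Y\<close>, written with the transpose to match the duality lemma.\<close>

definition dual_domain :: "(real^'d^'m) set \<Rightarrow> (real^'m) set" where
  "dual_domain Y = {l. \<forall>u\<in>Y. l v* u \<in> mgf_domain M (Z 1)}"

lemma measurable_Z [measurable]: "Z i \<in> borel_measurable M"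
  using indep by (auto simp: indep_vars_def)

lemma measurable_weighted_mean [measurable]: "weighted_mean n \<in> borel_measurable M"
proof -
  have [measurable]: "(\<lambda>v. A *v v) \<in> borel_measurable borel" for A :: "real^'d^'m"
    by (intro borel_measurable_continuous_onI linear_continuous_on m.bounded_linear_right)
  show ?thesis
    unfolding weighted_mean_def by measurable
qed

lemma nn_integral_Z:
  assumes [measurable]: "g \<in> borel_measurable borel"
  shows "(\<integral>\<^sup>+\<omega>. g (Z i \<omega>) \<partial>M) = (\<integral>\<^sup>+\<omega>. g (Z 1 \<omega>) \<partial>M)"
  using arg_cong[OF ident[of i], of "\<lambda>N. \<integral>\<^sup>+z. g z \<partial>N"] by (simp add: nn_integral_distr)

lemma prob_Z:
  assumes "B \<in> sets borel"
  shows "prob (Z i -` B \<inter> space M) = prob (Z 1 -` B \<inter> space M)"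
  using arg_cong[OF ident[of i], of "\<lambda>N. measure N B"] assms by (simp add: measure_distr)

lemma outer_limit_subset_K: "outer_limit (\<lambda>n. y n ` C n) \<subseteq> K"
  by (rule outer_limit_subset[OF compact_K y_in_K])

lemma cball_subset_dual_domain:
  assumes "Y \<subseteq> K"
  obtains r where "0 < r" "cball 0 r \<subseteq> dual_domain Y"
proof -
  obtain b where b: "0 < b" "\<And>u. u \<in> K \<Longrightarrow> norm u \<le> b"
    using compact_imp_bounded[OF compact_K] bounded_pos by metis
  obtain k where k: "0 < k" "\<And>l u. norm (l v* u) \<le> norm (l :: real^'m) * norm (u :: real^'d^'m) * k"
    using v.pos_bounded by metis
  show ?thesis
  proof (rule that)
    \<comment> \<open>\<open>b\<close> bounds the weights in \<open>K\<close> and \<open>k\<close>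
      is the constant of the bilinear map, so this radius keeps the norm of \<open>l v* u\<close>
      within \<open>\<alpha>\<close>.\<close>
    show "0 < \<alpha> / (b * k)"
      using b k exp_moment by simp
    show "cball 0 (\<alpha> / (b * k)) \<subseteq> dual_domain Y"
    proof
      fix l assume l: "l \<in> cball (0::real^'m) (\<alpha> / (b * k))"
      have "norm (l v* u) \<le> \<alpha>" if "u \<in> Y" for u
      proof -
        have "norm (l v* u) \<le> norm l * norm u * k"
          by (rule k)
        also have "\<dots> \<le> (\<alpha> / (b * k)) * b * k"
          using l b that assms k exp_moment by (intro mult_mono) auto
        also have "\<dots> = \<alpha>"
          using b k by simp
        finally show ?thesis .
      qed
      then show "l \<in> dual_domain Y"
        using cball_subset_mgf_domain[OF exp_moment(2)] by (auto simp: dual_domain_def)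
    qed
  qed
qed

section \<open>Upper bound: half spaces, then closed sets\<close>

text \<open>Shrinking by \<open>t < 1\<close> gives a local bound at every limit weight; compactness
  of \<open>K\<close> makes it uniform over all weights of large index.\<close>

lemma eventually_mgf_bounded:
  assumes "l \<in> dual_domain (outer_limit (\<lambda>n. y n ` C n))" "0 \<le> t" "t < 1"
  obtains B :: real where "0 < B" "\<forall>\<^sub>F n in sequentially. \<forall>i\<in>C n.
    (\<integral>\<^sup>+\<omega>. ennreal (exp (inner ((t *\<^sub>R l) v* y n i) (Z i \<omega>))) \<partial>M) \<le> ennreal B"
proof -
  let ?h = "\<lambda>u. \<integral>\<^sup>+\<omega>. ennreal (exp (inner ((t *\<^sub>R l) v* u) (Z 1 \<omega>))) \<partial>M"
  have "\<exists>B::real. \<forall>\<^sub>F u' in nhds u. ?h u' \<le> ennreal B"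
    if "u \<in> outer_limit (\<lambda>n. y n ` C n)" for u
  proof -
    have "l v* u \<in> mgf_domain M (Z 1)"
      using assms that by (auto simp: dual_domain_def)
    then obtain B :: real where B: "\<forall>\<^sub>F \<eta> in nhds (t *\<^sub>R (l v* u)).
        (\<integral>\<^sup>+\<omega>. ennreal (exp (inner \<eta> (Z 1 \<omega>))) \<partial>M) \<le> ennreal B"
      using mgf_locally_bounded[OF measurable_Z exp_moment _ assms(2,3)] by blast
    have "((\<lambda>u'. (t *\<^sub>R l) v* u') \<longlongrightarrow> (t *\<^sub>R l) v* u) (nhds u)"
      by (intro v.tendsto tendsto_const filterlim_ident)
    from filterlim_iff[THEN iffD1, rule_format, OF this B[folded v.scaleR_left]] show ?thesis ..
  qed
  from eventually_bounded_if_locally_bounded_outer_limit[where D = "\<lambda>n. y n ` C n", OF compact_K y_in_K this]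
  obtain B :: real where B: "\<forall>\<^sub>F n in sequentially. \<forall>u\<in>y n ` C n. ?h u \<le> ennreal B"
    by blast
  show ?thesis
  \<comment> \<open>The maximum with 1 makes the constant positive, so that its logarithm can be
    taken later.\<close>
  proof (rule that[of "max B 1"])
    show "\<forall>\<^sub>F n in sequentially. \<forall>i\<in>C n.
      (\<integral>\<^sup>+\<omega>. ennreal (exp (inner ((t *\<^sub>R l) v* y n i) (Z i \<omega>))) \<partial>M) \<le> ennreal (max B 1)"
      using B
    proof eventually_elim
      case (elim n)
      show ?case
      proof
        fix i assume "i \<in> C n"
        have "(\<integral>\<^sup>+\<omega>. ennreal (exp (inner ((t *\<^sub>R l) v* y n i) (Z i \<omega>))) \<partial>M) = ?h (y n i)"
          by (rule nn_integral_Z) simp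
        also have "\<dots> \<le> ennreal B"
          using elim \<open>i \<in> C n\<close> by blast
        also have "\<dots> \<le> ennreal (max B 1)"
          by (intro ennreal_leI) simp
        finally show "(\<integral>\<^sup>+\<omega>. ennreal (exp (inner ((t *\<^sub>R l) v* y n i) (Z i \<omega>))) \<partial>M) \<le>
          ennreal (max B 1)" .
      qed
    qed
  qed simp
qed

lemma prob_halfspace_le:
  assumes "l \<in> dual_domain (outer_limit (\<lambda>n. y n ` C n))" "0 \<le> t" "t < 1"
  shows "\<exists>B>0. \<forall>\<^sub>F n in sequentially.
    prob {\<omega>\<in>space M. c < inner (t *\<^sub>R l) (weighted_mean n \<omega>)} \<le>
      exp (- (real n * c)) * B ^ card (C n)"
proof -
  obtain B :: real where B: "0 < B" "\<forall>\<^sub>F n in sequentially. \<forall>i\<in>C n.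
      (\<integral>\<^sup>+\<omega>. ennreal (exp (inner ((t *\<^sub>R l) v* y n i) (Z i \<omega>))) \<partial>M) \<le> ennreal B"
    using eventually_mgf_bounded[OF assms] by blast
  have "\<forall>\<^sub>F n in sequentially. prob {\<omega>\<in>space M. c < inner (t *\<^sub>R l) (weighted_mean n \<omega>)} \<le>
      exp (- (real n * c)) * B ^ card (C n)"
    using B(2) eventually_gt_at_top[of 0]
  proof eventually_elim
    case (elim n)
    let ?X = "\<lambda>i \<omega>. inner ((t *\<^sub>R l) v* y n i) (Z i \<omega>)"
    have "c < inner (t *\<^sub>R l) (weighted_mean n \<omega>) \<longleftrightarrow> real n * c < (\<Sum>i\<in>C n. ?X i \<omega>)" for \<omega>
      using elim by (simp add: weighted_mean_def inner_sum_right dot_lmul_matrix field_simps)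
    then have "prob {\<omega>\<in>space M. c < inner (t *\<^sub>R l) (weighted_mean n \<omega>)} \<le>
        prob {\<omega>\<in>space M. real n * c \<le> (\<Sum>i\<in>C n. ?X i \<omega>)}"
      by (intro finite_measure_mono) auto
    also have "\<dots> \<le> exp (- (real n * c)) * B ^ card (C n)"
    proof (rule prob_sum_ge_le)
      show "indep_vars (\<lambda>_. borel) ?X (C n)"
        by (rule indep_vars_compose2[OF indep_vars_subset[OF indep]]) auto
    qed (use elim B finite_C in auto)
    finally show ?case .
  qed
  with B(1) show ?thesis
    by blast
qed

lemma limsup_weighted_mean_le:
  assumes F: "closed F"
    and c: "\<And>z. z \<in> F \<Longrightarrow> ereal c < support_fun (dual_domain (outer_limit (\<lambda>n. y n ` C n))) z"
  shows "limsup (\<lambda>n. ereal (1 / real n) * eln (prob {\<omega>\<in>space M. weighted_mean n \<omega> \<in> F})) \<le> ereal (- c)"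
proof -
  let ?D = "dual_domain (outer_limit (\<lambda>n. y n ` C n))"
  \<comment> \<open>The half-space estimate is available only for shrunk multipliers;
    \<open>L\<close> collects them.\<close>
  define L where "L = {t *\<^sub>R l | t l. 0 \<le> t \<and> t < (1::real) \<and> l \<in> ?D}"
  obtain r where r: "0 < r" "cball 0 r \<subseteq> ?D"
    using cball_subset_dual_domain[OF outer_limit_subset_K] by blast
  have ball: "cball 0 (r / 2) \<subseteq> L"
  proof
    fix l :: "real^'m" assume "l \<in> cball 0 (r / 2)"
    then have "2 *\<^sub>R l \<in> ?D"
      using r by (intro subsetD[OF r(2)]) auto
    then show "l \<in> L"
      unfolding L_def by (auto intro!: exI[of _ "1/2::real"] exI[of _ "2 *\<^sub>R l"])
  qed
  have cover: "\<exists>l\<in>L. c < inner l z" if z: "z \<in> F" for z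
  proof -
    obtain l where l: "l \<in> ?D" "c < inner z l"
      using c[OF z] by (auto simp: support_fun_def less_SUP_iff)
    \<comment> \<open>The inequality is strict, so it survives replacing \<open>l\<close> by
      \<open>t *\<^sub>R l\<close> with \<open>t\<close> close to 1.\<close>
    have "((\<lambda>t. t * inner l z) \<longlongrightarrow> 1 * inner l z) (at_left 1)"
      by (intro tendsto_intros)
    then have "\<forall>\<^sub>F t in at_left 1. c < t * inner l z"
      by (rule order_tendstoD) (use l in \<open>simp add: inner_commute\<close>)
    moreover have "\<forall>\<^sub>F t in at_left (1::real). t \<in> {0<..<1}"
      by (rule eventually_at_left_real) simp
    ultimately have "\<forall>\<^sub>F t in at_left (1::real). \<exists>l\<in>L. c < inner l z"
    proof eventually_elim
      case (elim t)
      then show ?case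
        using l(1) unfolding L_def by (intro bexI[of _ "t *\<^sub>R l"]) force+
    qed
    then show ?thesis
      by (auto dest: eventually_happens)
  qed
  obtain S where S: "finite S" "S \<subseteq> L" "F \<subseteq> (\<Union>l\<in>S. {z. c < inner l z})"
    using finite_halfspace_cover[OF F ball half_gt_zero[OF r(1)] cover] by blast
  let ?H = "\<lambda>n l. {\<omega>\<in>space M. c < inner l (weighted_mean n \<omega>)}"
  have "\<forall>l\<in>S. \<exists>B>0. \<forall>\<^sub>F n in sequentially. prob (?H n l) \<le> exp (- (real n * c)) * B ^ card (C n)"
    using S(2) prob_halfspace_le unfolding L_def by blast
  then obtain B where B: "\<And>l. l \<in> S \<Longrightarrow> 0 < B l"
      "\<And>l. l \<in> S \<Longrightarrow> \<forall>\<^sub>F n in sequentially. prob (?H n l) \<le> exp (- (real n * c)) * B l ^ card (C n)"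
    by (auto dest!: bchoice)
  \<comment> \<open>One base dominating all \<open>B l\<close>. The summand 1, like that in
    \<open>real (card S) + 1\<close> below, keeps the constant positive for empty
    \<open>S\<close>.\<close>
  define b where "b = 1 + (\<Sum>l\<in>S. B l)"
  have "0 \<le> (\<Sum>l\<in>S. B l)"
    using B(1) by (intro sum_nonneg less_imp_le)
  moreover have "B l \<le> (\<Sum>l\<in>S. B l)" if "l \<in> S" for l
    using that S(1) B(1) by (intro member_le_sum less_imp_le) auto
  ultimately have b: "0 < b" "\<And>l. l \<in> S \<Longrightarrow> B l \<le> b"
    unfolding b_def by (auto intro: add_increasing)
  have "\<forall>\<^sub>F n in sequentially. \<forall>l\<in>S. prob (?H n l) \<le> exp (- (real n * c)) * B l ^ card (C n)"
    using S(1) B(2) by (intro eventually_ball_finite) auto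
  then have "\<forall>\<^sub>F n in sequentially. prob {\<omega>\<in>space M. weighted_mean n \<omega> \<in> F} \<le>
      (real (card S) + 1) * exp (- (real n * c)) * b ^ card (C n)"
  proof eventually_elim
    case (elim n)
    have "prob {\<omega>\<in>space M. weighted_mean n \<omega> \<in> F} \<le> prob (\<Union>l\<in>S. ?H n l)"
      using S by (intro finite_measure_mono) auto
    also have "\<dots> \<le> (\<Sum>l\<in>S. prob (?H n l))"
      using S(1) by (intro finite_measure_subadditive_finite) auto
    also have "\<dots> \<le> (\<Sum>l\<in>S. exp (- (real n * c)) * b ^ card (C n))"
    proof (rule sum_mono)
      fix l assume "l \<in> S"
      then have "prob (?H n l) \<le> exp (- (real n * c)) * B l ^ card (C n)"
        using elim by blast
      also have "\<dots> \<le> exp (- (real n * c)) * b ^ card (C n)"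
        using b(2) B(1) \<open>l \<in> S\<close> by (intro mult_left_mono power_mono) (auto intro: less_imp_le)
      finally show "prob (?H n l) \<le> exp (- (real n * c)) * b ^ card (C n)" .
    qed
    also have "\<dots> \<le> (real (card S) + 1) * exp (- (real n * c)) * b ^ card (C n)"
      using b by (simp add: algebra_simps)
    finally show ?case .
  qed
  then show ?thesis
    by (intro limsup_eln_le[OF card_C _ b(1)]) auto
qed

section \<open>Lower bound: prescribing the individual variables\<close>

text \<open>Every index in \<open>J\<close> carries exactly one event, so independence gives a
  product, and identical distribution replaces each \<open>Z i\<close> by
  \<open>Z 1\<close>.\<close>

lemma prob_independent_pattern_ge:
  assumes J: "finite J" "J \<noteq> {}" and \<iota>: "inj_on \<iota> F" "\<iota> ` F \<subseteq> J"
    and B: "\<And>u. u \<in> F \<Longrightarrow> B u \<in> sets borel" and Q: "Q \<in> sets borel"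
  shows "(\<Prod>u\<in>F. prob (Z 1 -` B u \<inter> space M)) * prob (Z 1 -` Q \<inter> space M) ^ card J \<le>
    prob {\<omega>\<in>space M. (\<forall>u\<in>F. Z (\<iota> u) \<omega> \<in> B u) \<and> (\<forall>i\<in>J - \<iota> ` F. Z i \<omega> \<in> Q)}"
proof -
  define E where "E i = (if i \<in> \<iota> ` F then B (the_inv_into F \<iota> i) else Q)" for i
  have E_\<iota>: "E (\<iota> u) = B u" if "u \<in> F" for u
    using that \<iota>(1) by (simp add: E_def the_inv_into_f_f)
  have E: "E i \<in> sets borel" for i
  proof (cases "i \<in> \<iota> ` F")
    case True
    then show ?thesis
      using B E_\<iota> by auto
  next
    case False
    then show ?thesis
      using Q by (simp add: E_def)
  qed
  \<comment> \<open>Probabilities are at most 1, so the larger exponent \<open>card J\<close> only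
    lowers the bound.\<close>
  have "card (J - \<iota> ` F) \<le> card J"
    using J by (intro card_mono) auto
  then have "prob (Z 1 -` Q \<inter> space M) ^ card J \<le> prob (Z 1 -` Q \<inter> space M) ^ card (J - \<iota> ` F)"
    by (intro power_decreasing) auto
  then have "(\<Prod>u\<in>F. prob (Z 1 -` B u \<inter> space M)) * prob (Z 1 -` Q \<inter> space M) ^ card J \<le>
      (\<Prod>u\<in>F. prob (Z 1 -` B u \<inter> space M)) * prob (Z 1 -` Q \<inter> space M) ^ card (J - \<iota> ` F)"
    by (intro mult_left_mono prod_nonneg) auto
  also have "\<dots> = (\<Prod>i\<in>\<iota> ` F. prob (Z 1 -` E i \<inter> space M)) *
      (\<Prod>i\<in>J - \<iota> ` F. prob (Z 1 -` E i \<inter> space M))"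
  proof -
    have "(\<Prod>i\<in>\<iota> ` F. prob (Z 1 -` E i \<inter> space M)) = (\<Prod>u\<in>F. prob (Z 1 -` B u \<inter> space M))"
      using \<iota>(1) by (simp add: prod.reindex E_\<iota>)
    moreover have "(\<Prod>i\<in>J - \<iota> ` F. prob (Z 1 -` E i \<inter> space M)) =
        (\<Prod>i\<in>J - \<iota> ` F. prob (Z 1 -` Q \<inter> space M))"
      by (intro prod.cong) (auto simp: E_def)
    ultimately show ?thesis
      by simp
  qed
  also have "\<dots> = (\<Prod>i\<in>J. prob (Z 1 -` E i \<inter> space M))"
    by (subst prod.subset_diff[OF \<iota>(2) J(1)]) (simp add: mult.commute)
  also have "\<dots> = (\<Prod>i\<in>J. prob (Z i -` E i \<inter> space M))"
    using E by (intro prod.cong refl prob_Z[symmetric])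
  also have "\<dots> = prob (\<Inter>i\<in>J. Z i -` E i \<inter> space M)"
    using E J by (intro indep_varsD[OF indep, symmetric]) auto
  also have "(\<Inter>i\<in>J. Z i -` E i \<inter> space M) =
      {\<omega>\<in>space M. (\<forall>u\<in>F. Z (\<iota> u) \<omega> \<in> B u) \<and> (\<forall>i\<in>J - \<iota> ` F. Z i \<omega> \<in> Q)}" (is "?l = ?r")
  proof (intro subset_antisym subsetI)
    fix \<omega> assume "\<omega> \<in> ?l"
    then have \<omega>: "\<omega> \<in> space M" "\<And>i. i \<in> J \<Longrightarrow> Z i \<omega> \<in> E i"
      using J(2) by auto
    show "\<omega> \<in> ?r"
    proof (intro CollectI conjI ballI \<omega>(1))
      fix u assume "u \<in> F"
      then show "Z (\<iota> u) \<omega> \<in> B u"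
        using \<omega>(2)[of "\<iota> u"] E_\<iota> \<iota>(2) by auto
    next
      fix i assume "i \<in> J - \<iota> ` F"
      then show "Z i \<omega> \<in> Q"
        using \<omega>(2)[of i] by (simp add: E_def)
    qed
  next
    fix \<omega> assume \<omega>: "\<omega> \<in> ?r"
    have "Z i \<omega> \<in> E i" if "i \<in> J" for i
    proof (cases "i \<in> \<iota> ` F")
      case True
      then show ?thesis
        using \<omega> E_\<iota> by auto
    next
      case False
      then show ?thesis
        using \<omega> that by (simp add: E_def)
    qed
    then show "\<omega> \<in> ?l"
      using \<omega> by auto
  qed
  finally show ?thesis .
qed

text \<open>The preimages of growing balls exhaust \<open>space M\<close>; were all of them null,
  the whole space would be.\<close>

lemma prob_norm_le_pos: obtains R where "0 < R" "0 < prob (Z 1 -` cball 0 R \<inter> space M)"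
proof (rule ccontr)
  assume no: "\<not> thesis"
  have "emeasure M (\<Union>k. Z 1 -` cball 0 (real (Suc k)) \<inter> space M) = 0"
  proof (rule emeasure_UN_eq_0)
    fix k
    have "\<not> 0 < prob (Z 1 -` cball 0 (real (Suc k)) \<inter> space M)"
      using no that[of "real (Suc k)"] by (metis of_nat_0_less_iff zero_less_Suc)
    then show "emeasure M (Z 1 -` cball 0 (real (Suc k)) \<inter> space M) = 0"
      by (simp add: emeasure_eq_measure not_less measure_le_0_iff)
  qed auto
  moreover have "(\<Union>k. Z 1 -` cball 0 (real (Suc k)) \<inter> space M) = space M"
  proof (intro subset_antisym subsetI)
    fix \<omega> assume "\<omega> \<in> space M"
    moreover obtain k where "norm (Z 1 \<omega>) \<le> real k"
      using real_arch_simple by blast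
    ultimately show "\<omega> \<in> (\<Union>k. Z 1 -` cball 0 (real (Suc k)) \<inter> space M)"
      by (auto intro!: exI[of _ k])
  qed auto
  ultimately show False
    using emeasure_space_1 by simp
qed

text \<open>The variables at indices \<open>\<iota> u n\<close> are sent near
  \<open>real n *\<^sub>R w u\<close>, which produces the costs in the sum. The others stay bounded
  at subexponential cost and shift the mean by order \<open>card (C n) / n\<close>.\<close>

lemma liminf_weighted_mean_ge_sum:
  assumes LDP_Z: "LDP M (\<lambda>n \<omega>. (1 / real n) *\<^sub>R Z 1 \<omega>) (support_fun (mgf_domain M (Z 1)))"
    and F: "finite F" "F \<subseteq> inner_limit (\<lambda>n. y n ` C n)"
    and s: "(\<Sum>u\<in>F. support_fun (mgf_domain M (Z 1)) (w u)) \<le> ereal s"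
    and \<Gamma>: "\<Gamma> \<in> sets borel" "(\<Sum>u\<in>F. u *v w u) \<in> interior \<Gamma>"
  shows "ereal (- s) \<le> liminf (\<lambda>n. ereal (1 / real n) * eln (prob {\<omega>\<in>space M. weighted_mean n \<omega> \<in> \<Gamma>}))"
    (is "_ \<le> ?liminf")
proof -
  let ?I = "support_fun (mgf_domain M (Z 1))"
  let ?z = "\<Sum>u\<in>F. u *v w u"
  have "0 \<in> mgf_domain M (Z 1)"
    using cball_subset_mgf_domain[OF exp_moment(2)] exp_moment(1) by auto
  then have I_nonneg: "0 \<le> ?I v" for v
    by (rule support_fun_nonneg)
  \<comment> \<open>A finite sum of nonnegative costs has finite terms, so real values
    \<open>r u\<close> can replace them.\<close>
  have "?I (w u) \<noteq> \<infinity>" if "u \<in> F" for u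
    using s that F(1) sum_Pinfty[of "\<lambda>u. ?I (w u)" F] by auto
  then have "\<exists>r. ?I (w u) = ereal r" if "u \<in> F" for u
    using that I_nonneg[of "w u"] by (cases "?I (w u)") auto
  then obtain r where r: "\<And>u. u \<in> F \<Longrightarrow> ?I (w u) = ereal (r u)"
    by metis
  have sum_r: "(\<Sum>u\<in>F. r u) \<le> s"
    using s r by simp
  obtain \<epsilon> where \<epsilon>: "0 < \<epsilon>" "ball ?z \<epsilon> \<subseteq> \<Gamma>"
    using \<Gamma>(2) mem_interior by blast
  \<comment> \<open>The inner limit supplies weights for all large \<open>n\<close>, not just along
    a subsequence, as a liminf bound requires.\<close>
  have "\<exists>\<iota>. (\<forall>\<^sub>F n in sequentially. \<iota> n \<in> C n) \<and> (\<lambda>n. y n (\<iota> n)) \<longlonglongrightarrow> u" if u: "u \<in> F" for u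
  proof -
    obtain n0 xs where xs: "\<And>n. n0 \<le> n \<Longrightarrow> xs n \<in> y n ` C n" "xs \<longlonglongrightarrow> u"
      using subsetD[OF F(2) u] unfolding inner_limit_def by blast
    then obtain \<iota> where \<iota>: "\<And>n. n0 \<le> n \<Longrightarrow> \<iota> n \<in> C n \<and> xs n = y n (\<iota> n)"
      unfolding image_iff by metis
    have "(\<lambda>n. y n (\<iota> n)) \<longlonglongrightarrow> u"
      using xs(2) by (rule Lim_transform_eventually)
        (use \<iota> in \<open>auto simp: eventually_sequentially intro!: exI[of _ n0]\<close>)
    then show ?thesis
      using \<iota> by (auto simp: eventually_sequentially)
  qed
  then obtain \<iota> where \<iota>: "\<And>u. u \<in> F \<Longrightarrow> \<forall>\<^sub>F n in sequentially. \<iota> u n \<in> C n"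
      "\<And>u. u \<in> F \<Longrightarrow> (\<lambda>n. y n (\<iota> u n)) \<longlonglongrightarrow> u"
    by metis
  have ev_C: "\<forall>\<^sub>F n in sequentially. \<forall>u\<in>F. \<iota> u n \<in> C n"
    using F(1) \<iota>(1) by (intro eventually_ball_finite) auto
  \<comment> \<open>Distinct limits keep the weights apart, so distinct elements of \<open>F\<close>
    eventually use distinct, hence independent, variables.\<close>
  have ev_inj: "\<forall>\<^sub>F n in sequentially. inj_on (\<lambda>u. \<iota> u n) F"
  proof -
    have "\<forall>\<^sub>F n in sequentially. u \<noteq> v \<longrightarrow> \<iota> u n \<noteq> \<iota> v n" if "u \<in> F" "v \<in> F" for u v
    proof (cases "u = v")
      case False
      have "(\<lambda>n. dist (y n (\<iota> u n)) (y n (\<iota> v n))) \<longlonglongrightarrow> dist u v"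
        using that by (intro tendsto_dist \<iota>(2))
      then have "\<forall>\<^sub>F n in sequentially. 0 < dist (y n (\<iota> u n)) (y n (\<iota> v n))"
        by (rule order_tendstoD) (use False in simp)
      then show ?thesis
        by eventually_elim auto
    qed simp
    then have "\<forall>\<^sub>F n in sequentially. \<forall>u\<in>F. \<forall>v\<in>F. u \<noteq> v \<longrightarrow> \<iota> u n \<noteq> \<iota> v n"
      using F(1) by (intro eventually_ball_finite ballI) auto
    then show ?thesis
      by eventually_elim (auto simp: inj_on_def)
  qed
  \<comment> \<open>Summed over \<open>F\<close> these errors stay within
    \<open>\<epsilon> / 2\<close>; the added 1 avoids division by zero for empty
    \<open>F\<close>.\<close>
  define \<epsilon>' where "\<epsilon>' = \<epsilon> / (2 * (real (card F) + 1))"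
  have "0 < \<epsilon>'"
    using \<epsilon>(1) by (simp add: \<epsilon>'_def)
  have "\<exists>\<delta>>0. \<forall>a v. dist a u < \<delta> \<longrightarrow> dist v (w u) < \<delta> \<longrightarrow> dist (a *v v) (u *v w u) < \<epsilon>'" for u
  proof -
    have "((\<lambda>p. fst p *v snd p) \<longlongrightarrow> fst (u, w u) *v snd (u, w u)) (nhds (u, w u))"
      by (intro m.tendsto tendsto_fst tendsto_snd filterlim_ident)
    then have "\<forall>\<^sub>F p in nhds (u, w u). dist (fst p *v snd p) (u *v w u) < \<epsilon>'"
      using \<open>0 < \<epsilon>'\<close> by (auto dest: tendstoD)
    then obtain \<delta> where \<delta>: "0 < \<delta>"
        "\<And>p. dist p (u, w u) < \<delta> \<Longrightarrow> dist (fst p *v snd p) (u *v w u) < \<epsilon>'"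
      unfolding eventually_nhds_metric by blast
    show ?thesis
    proof (intro exI[of _ "\<delta> / 2"] conjI allI impI)
      fix a v assume "dist a u < \<delta> / 2" "dist v (w u) < \<delta> / 2"
      then have "dist (a, v) (u, w u) < \<delta>"
        unfolding dist_Pair_Pair
        using sqrt_sum_squares_le_sum[of "dist a u" "dist v (w u)"] by simp
      from \<delta>(2)[OF this] show "dist (a *v v) (u *v w u) < \<epsilon>'"
        by simp
    qed (use \<delta> in simp)
  qed
  then obtain \<delta> where \<delta>: "\<And>u. 0 < \<delta> u"
      "\<And>u a v. dist a u < \<delta> u \<Longrightarrow> dist v (w u) < \<delta> u \<Longrightarrow> dist (a *v v) (u *v w u) < \<epsilon>'"
    by metis
  have ev_close: "\<forall>\<^sub>F n in sequentially. \<forall>u\<in>F. dist (y n (\<iota> u n)) u < \<delta> u"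
    using F(1) \<delta>(1) tendstoD[OF \<iota>(2)] by (intro eventually_ball_finite) auto
  obtain R where R: "0 < R" "0 < prob (Z 1 -` cball 0 R \<inter> space M)"
    by (rule prob_norm_le_pos)
  define q where "q = prob (Z 1 -` cball 0 R \<inter> space M)"
  obtain b where b: "0 < b" "\<And>u. u \<in> K \<Longrightarrow> norm u \<le> b"
    using compact_imp_bounded[OF compact_K] bounded_pos by metis
  obtain k where k: "0 < k" "\<And>u v. norm (u *v v) \<le> norm (u :: real^'d^'m) * norm (v :: real^'d) * k"
    using m.pos_bounded by metis
  \<comment> \<open>This quantity bounds the contribution of the remaining variables, each summand
    being at most \<open>b * R * k / real n\<close>.\<close>
  have ev_rest: "\<forall>\<^sub>F n in sequentially. real (card (C n)) / real n * (b * R * k) < \<epsilon> / 2"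
  proof -
    have "(\<lambda>n. real (card (C n)) / real n * (b * R * k)) \<longlonglongrightarrow> 0 * (b * R * k)"
      by (intro tendsto_mult card_C tendsto_const)
    then show ?thesis
      by (rule order_tendstoD) (use \<epsilon> in simp)
  qed
  let ?A = "\<lambda>n u. {v. (1 / real n) *\<^sub>R v \<in> ball (w u) (\<delta> u)}"
  have A_borel: "?A n u \<in> sets borel" for n u
  proof -
    have "open ((\<lambda>v. (1 / real n) *\<^sub>R v) -` ball (w u) (\<delta> u))"
      by (intro open_vimage open_ball continuous_intros)
    then show ?thesis
      by (simp add: vimage_def)
  qed
  \<comment> \<open>The LDP controls the single probabilities only in the limit, so a slack
    \<open>e\<close> is paid for each element of \<open>F\<close> and sent to 0 at the end.\<close>
  have main: "ereal (- ((\<Sum>u\<in>F. r u) + real (card F) * e)) \<le> ?liminf" if "0 < e" for e :: real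
  proof (rule liminf_eln_ge[OF card_C])
    show "0 < q"
      using R by (simp add: q_def)
    have "\<forall>\<^sub>F n in sequentially. exp (- (real n * (r u + e))) \<le> prob (Z 1 -` ?A n u \<inter> space M)"
      if "u \<in> F" for u
    proof -
      let ?p = "\<lambda>n. prob {\<omega>\<in>space M. (1 / real n) *\<^sub>R Z 1 \<omega> \<in> ball (w u) (\<delta> u)}"
      have "(INF v\<in>interior (ball (w u) (\<delta> u)). ?I v) \<le> ?I (w u)"
        using \<delta>(1)[of u] by (intro INF_lower) simp
      then have "ereal (- (r u)) \<le> - (INF v\<in>interior (ball (w u) (\<delta> u)). ?I v)"
        using r[OF \<open>u \<in> F\<close>] by (metis ereal_minus_le_minus uminus_ereal.simps(1))
      also have "\<dots> \<le> liminf (\<lambda>n. ereal (1 / real n) * eln (?p n))"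
        using LDP_Z unfolding LDP_def by (meson borel_open open_ball)
      finally have "ereal (- (r u)) \<le> liminf (\<lambda>n. ereal (1 / real n) * eln (?p n))" .
      moreover have "ereal (- (r u + e)) < ereal (- r u)"
        using \<open>0 < e\<close> by simp
      ultimately have "ereal (- (r u + e)) < liminf (\<lambda>n. ereal (1 / real n) * eln (?p n))"
        by (rule less_le_trans[rotated])
      from eventually_ge_if_less_liminf_eln[OF this] show ?thesis
        by (simp add: vimage_def Int_def conj_commute)
    qed
    then have "\<forall>\<^sub>F n in sequentially. \<forall>u\<in>F.
        exp (- (real n * (r u + e))) \<le> prob (Z 1 -` ?A n u \<inter> space M)"
      using F(1) by (intro eventually_ball_finite) auto
    then show "\<forall>\<^sub>F n in sequentially. exp (- (real n * ((\<Sum>u\<in>F. r u) + real (card F) * e))) * q ^ card (C n)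
        \<le> prob {\<omega>\<in>space M. weighted_mean n \<omega> \<in> \<Gamma>}"
      using ev_C ev_inj ev_close ev_rest eventually_ge_at_top[of 1]
    proof eventually_elim
      case (elim n)
      let ?J = "(\<lambda>u. \<iota> u n) ` F"
      let ?E = "{\<omega>\<in>space M. (\<forall>u\<in>F. Z (\<iota> u n) \<omega> \<in> ?A n u) \<and> (\<forall>i\<in>C n - ?J. Z i \<omega> \<in> cball 0 R)}"
      have J: "?J \<subseteq> C n"
        using elim by auto
      have "exp (- (real n * ((\<Sum>u\<in>F. r u) + real (card F) * e))) = (\<Prod>u\<in>F. exp (- (real n * (r u + e))))"
        using F(1) by (simp add: exp_sum[symmetric] sum_negf sum_distrib_left[symmetric] sum.distrib)
      also have "\<dots> \<le> (\<Prod>u\<in>F. prob (Z 1 -` ?A n u \<inter> space M))"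
        using elim by (intro prod_mono) auto
      finally have "exp (- (real n * ((\<Sum>u\<in>F. r u) + real (card F) * e))) * q ^ card (C n) \<le>
          (\<Prod>u\<in>F. prob (Z 1 -` ?A n u \<inter> space M)) * q ^ card (C n)"
        by (intro mult_right_mono) (auto simp: q_def)
      also have "\<dots> \<le> prob ?E"
        unfolding q_def
        using finite_C nonempty_C elim J A_borel by (intro prob_independent_pattern_ge) auto
      also have "\<dots> \<le> prob {\<omega>\<in>space M. weighted_mean n \<omega> \<in> \<Gamma>}"
      proof (rule finite_measure_mono)
        show "{\<omega>\<in>space M. weighted_mean n \<omega> \<in> \<Gamma>} \<in> sets M"
          using \<Gamma>(1) by measurable
        show "?E \<subseteq> {\<omega>\<in>space M. weighted_mean n \<omega> \<in> \<Gamma>}"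
        proof
          fix \<omega> assume \<omega>: "\<omega> \<in> ?E"
          let ?g = "\<lambda>i. y n i *v ((1 / real n) *\<^sub>R Z i \<omega>)"
          have "weighted_mean n \<omega> = (\<Sum>i\<in>C n. ?g i)"
            by (simp add: weighted_mean_def scaleR_sum_right m.scaleR_right)
          also have "\<dots> = (\<Sum>i\<in>C n - ?J. ?g i) + (\<Sum>u\<in>F. ?g (\<iota> u n))"
            using elim by (subst sum.subset_diff[OF J finite_C]) (simp add: sum.reindex)
          finally have "weighted_mean n \<omega> - ?z = (\<Sum>i\<in>C n - ?J. ?g i) + (\<Sum>u\<in>F. ?g (\<iota> u n) - u *v w u)"
            by (simp add: sum_subtractf)
          then have "norm (weighted_mean n \<omega> - ?z) \<le>
              (\<Sum>i\<in>C n - ?J. norm (?g i)) + (\<Sum>u\<in>F. norm (?g (\<iota> u n) - u *v w u))"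
            using norm_triangle_le[OF add_mono[OF norm_sum norm_sum]] by simp
          also have "(\<Sum>u\<in>F. norm (?g (\<iota> u n) - u *v w u)) \<le> (\<Sum>u\<in>F. \<epsilon>')"
          proof (rule sum_mono)
            fix u assume "u \<in> F"
            then have "dist (?g (\<iota> u n)) (u *v w u) < \<epsilon>'"
              using \<omega> elim by (intro \<delta>(2)) (auto simp: dist_commute)
            then show "norm (?g (\<iota> u n) - u *v w u) \<le> \<epsilon>'"
              by (simp add: dist_norm)
          qed
          also have "(\<Sum>u\<in>F. \<epsilon>') \<le> \<epsilon> / 2"
          proof -
            have "(\<Sum>u\<in>F. \<epsilon>') \<le> (real (card F) + 1) * \<epsilon>'"
              using \<open>0 < \<epsilon>'\<close> by (simp add: algebra_simps)
            also have "\<dots> = \<epsilon> / 2"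
              by (simp add: \<epsilon>'_def field_simps)
            finally show ?thesis .
          qed
          also have "(\<Sum>i\<in>C n - ?J. norm (?g i)) \<le> (\<Sum>i\<in>C n - ?J. b * R * k / real n)"
          proof (rule sum_mono)
            fix i assume i: "i \<in> C n - ?J"
            have "norm (?g i) \<le> norm (y n i) * norm ((1 / real n) *\<^sub>R Z i \<omega>) * k"
              by (rule k)
            also have "\<dots> \<le> b * (R / real n) * k"
            proof (intro mult_mono)
              show "norm (y n i) \<le> b"
                using i y_in_K elim b(2) by blast
              show "norm ((1 / real n) *\<^sub>R Z i \<omega>) \<le> R / real n"
                using \<omega> i by (simp add: divide_right_mono)
            qed (use b k R in auto)
            finally show "norm (?g i) \<le> b * R * k / real n"
              by simp
          qed
          also have "\<dots> \<le> (\<Sum>i\<in>C n. b * R * k / real n)"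
            using finite_C b k R by (intro sum_mono2) auto
          also have "\<dots> < \<epsilon> / 2"
            using elim by simp
          finally have "weighted_mean n \<omega> \<in> ball ?z \<epsilon>"
            by (simp add: dist_norm norm_minus_commute)
          then show "\<omega> \<in> {\<omega>\<in>space M. weighted_mean n \<omega> \<in> \<Gamma>}"
            using \<epsilon>(2) \<omega> by auto
        qed
      qed
      finally show ?case .
    qed
  qed
  have "((\<lambda>e. ereal (- ((\<Sum>u\<in>F. r u) + real (card F) * e))) \<longlongrightarrow>
      ereal (- ((\<Sum>u\<in>F. r u) + real (card F) * 0))) (at_right 0)"
    by (intro tendsto_intros)
  moreover have "\<forall>\<^sub>F e in at_right 0. ereal (- ((\<Sum>u\<in>F. r u) + real (card F) * e)) \<le> ?liminf"
    using eventually_at_right_less[of "0::real"] by eventually_elim (rule main)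
  ultimately have "ereal (- ((\<Sum>u\<in>F. r u) + real (card F) * 0)) \<le> ?liminf"
    by (rule tendsto_upperbound) simp
  moreover have "ereal (- s) \<le> ereal (- ((\<Sum>u\<in>F. r u) + real (card F) * 0))"
    using sum_r by simp
  ultimately show ?thesis
    by (rule order_trans[rotated])
qed

text \<open>Duality provides a point within \<open>e\<close> of \<open>z\<close>. For small
  \<open>e\<close> it stays in the open set \<open>interior \<Gamma>\<close>, and its cost bound
  \<open>c + e\<close> tends to \<open>c\<close>.\<close>

lemma liminf_weighted_mean_ge:
  assumes LDP_Z: "LDP M (\<lambda>n \<omega>. (1 / real n) *\<^sub>R Z 1 \<omega>) (support_fun (mgf_domain M (Z 1)))"
    and c: "support_fun (dual_domain (inner_limit (\<lambda>n. y n ` C n))) z \<le> ereal c"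
    and \<Gamma>: "\<Gamma> \<in> sets borel" "z \<in> interior \<Gamma>"
  shows "ereal (- c) \<le> liminf (\<lambda>n. ereal (1 / real n) * eln (prob {\<omega>\<in>space M. weighted_mean n \<omega> \<in> \<Gamma>}))"
    (is "_ \<le> ?liminf")
proof -
  obtain \<epsilon> where \<epsilon>: "0 < \<epsilon>" "ball z \<epsilon> \<subseteq> interior \<Gamma>"
    using \<Gamma>(2) open_contains_ball[of "interior \<Gamma>"] by auto
  have main: "ereal (- (c + e)) \<le> ?liminf" if e: "0 < e" "e < \<epsilon>" for e
  proof -
    obtain F w where F: "finite F" "F \<subseteq> inner_limit (\<lambda>n. y n ` C n)"
        "norm ((\<Sum>u\<in>F. u *v w u) - z) < e"
        "(\<Sum>u\<in>F. support_fun (mgf_domain M (Z 1)) (w u)) \<le> ereal (c + e)"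
      using support_fun_INT_approx[OF convex_mgf_domain[OF measurable_Z]
          cball_subset_mgf_domain[OF exp_moment(2)] exp_moment(1) c[unfolded dual_domain_def] e(1)]
      by blast
    have "(\<Sum>u\<in>F. u *v w u) \<in> interior \<Gamma>"
      using F(3) e by (intro subsetD[OF \<epsilon>(2)]) (simp add: dist_norm norm_minus_commute)
    then show ?thesis
      using liminf_weighted_mean_ge_sum[OF LDP_Z F(1,2,4) \<Gamma>(1)] by simp
  qed
  have "((\<lambda>e. ereal (- (c + e))) \<longlongrightarrow> ereal (- (c + 0))) (at_right 0)"
    by (intro tendsto_intros)
  moreover have "\<forall>\<^sub>F e in at_right 0. ereal (- (c + e)) \<le> ?liminf"
    using eventually_at_right_real[OF \<epsilon>(1)] by eventually_elim (use main in auto)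
  ultimately have "ereal (- (c + 0)) \<le> ?liminf"
    by (rule tendsto_upperbound) simp
  then show ?thesis
    by simp
qed

section \<open>Combination of the two bounds\<close>

theorem LDP_weighted_mean:
  assumes LDP_Z: "LDP M (\<lambda>n \<omega>. (1 / real n) *\<^sub>R Z 1 \<omega>) (support_fun (mgf_domain M (Z 1)))"
    and eq: "dual_domain (inner_limit (\<lambda>n. y n ` C n)) = dual_domain (outer_limit (\<lambda>n. y n ` C n))"
  shows "LDP M weighted_mean (support_fun (dual_domain (inner_limit (\<lambda>n. y n ` C n))))"
    (is "LDP M _ ?I")
  unfolding LDP_def
proof (intro conjI ballI)
  obtain r where "0 < r" "cball 0 r \<subseteq> dual_domain (inner_limit (\<lambda>n. y n ` C n))"
    using cball_subset_dual_domain[OF outer_limit_subset_K] unfolding eq by blast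
  then show "good_rate_function ?I"
    by (intro good_rate_function_support_fun)
  have I_nonneg: "0 \<le> ?I z" for z
    using \<open>good_rate_function ?I\<close> by (simp add: good_rate_function_def)
  fix \<Gamma> :: "(real^'m) set" assume \<Gamma>: "\<Gamma> \<in> sets borel"
  let ?r = "\<lambda>\<Gamma> n. ereal (1 / real n) * eln (prob {\<omega>\<in>space M. weighted_mean n \<omega> \<in> \<Gamma>})"
  have "- liminf (?r \<Gamma>) \<le> (INF z\<in>interior \<Gamma>. ?I z)"
  proof (rule INF_greatest)
    fix z assume z: "z \<in> interior \<Gamma>"
    show "- liminf (?r \<Gamma>) \<le> ?I z"
    proof (cases "?I z")
      case (real c)
      then have "ereal (- c) \<le> liminf (?r \<Gamma>)"
        using z \<Gamma> by (intro liminf_weighted_mean_ge[OF LDP_Z]) auto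
      then have "- liminf (?r \<Gamma>) \<le> - ereal (- c)"
        by (simp only: ereal_minus_le_minus)
      then show ?thesis
        using real by simp
    qed (use I_nonneg[of z] in auto)
  qed
  then have "- (INF z\<in>interior \<Gamma>. ?I z) \<le> - (- liminf (?r \<Gamma>))"
    by (simp only: ereal_minus_le_minus)
  then show "- (INF z\<in>interior \<Gamma>. ?I z) \<le> liminf (?r \<Gamma>)"
    by simp
  \<comment> \<open>It suffices to treat values strictly below the infimum: a real one is a strict
    lower bound for the rate on \<open>closure \<Gamma>\<close>, as the upper bound demands.\<close>
  have "(INF z\<in>closure \<Gamma>. ?I z) \<le> - limsup (?r \<Gamma>)"
  proof (rule dense_le)
    fix a assume a: "a < (INF z\<in>closure \<Gamma>. ?I z)"
    show "a \<le> - limsup (?r \<Gamma>)"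
    proof (cases a)
      case (real c)
      have "limsup (?r \<Gamma>) \<le> limsup (?r (closure \<Gamma>))"
      proof (intro Limsup_mono always_eventually allI ereal_mult_left_mono)
        fix n
        have [measurable]: "closure \<Gamma> \<in> sets borel"
          by simp
        have "{\<omega>\<in>space M. weighted_mean n \<omega> \<in> closure \<Gamma>} \<in> sets M"
          by measurable
        then have "prob {\<omega>\<in>space M. weighted_mean n \<omega> \<in> \<Gamma>} \<le> prob {\<omega>\<in>space M. weighted_mean n \<omega> \<in> closure \<Gamma>}"
          using closure_subset[of \<Gamma>] by (intro finite_measure_mono) auto
        then show "eln (prob {\<omega>\<in>space M. weighted_mean n \<omega> \<in> \<Gamma>}) \<le>
            eln (prob {\<omega>\<in>space M. weighted_mean n \<omega> \<in> closure \<Gamma>})"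
          by (auto simp: eln_def)
      qed simp
      \<comment> \<open>\<open>eq\<close> passes from the inner limit in the rate function to the
        outer limit that governs the upper bound.\<close>
      also have "\<dots> \<le> ereal (- c)"
        using a real unfolding eq by (intro limsup_weighted_mean_le) (auto dest: less_INF_D)
      finally have "- ereal (- c) \<le> - limsup (?r \<Gamma>)"
        by (simp only: ereal_minus_le_minus)
      then show ?thesis
        using real by simp
    qed (use a in auto)
  qed
  then have "- (- limsup (?r \<Gamma>)) \<le> - (INF z\<in>closure \<Gamma>. ?I z)"
    by (simp only: ereal_minus_le_minus)
  then show "limsup (?r \<Gamma>) \<le> - (INF z\<in>closure \<Gamma>. ?I z)"
    by simp
qed

end

theorem theorem2p1:
  fixes M :: "'a measure"
    and Z :: "nat \<Rightarrow> 'a \<Rightarrow> real^'d"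
    and f :: "'x::metric_space \<Rightarrow> real^'d^'m"
    and x :: "nat \<Rightarrow> nat \<Rightarrow> 'x"
    and C :: "nat \<Rightarrow> nat set"
  assumes prob: "prob_space M"
    and indep: "prob_space.indep_vars M (\<lambda>_. borel) Z UNIV"
    and ident: "\<And>i. distr M borel (Z i) = distr M borel (Z 1)"
    and A1_exp: "\<exists>\<alpha>>0. (\<integral>\<^sup>+\<omega>. ennreal (exp (\<alpha> * norm (Z 1 \<omega>))) \<partial>M) < \<infinity>"
    and A1A2_LDP: "LDP M (\<lambda>n \<omega>. (1 / real n) *\<^sub>R Z 1 \<omega>) (support_fun (mgf_domain M (Z 1)))"
    and f_cont: "continuous_on UNIV f"
    and C_sub: "\<And>n. C n \<subseteq> {1..n}"
    and C_card: "(\<lambda>n. real (card (C n)) / real n) \<longlonglongrightarrow> 0"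
    and A3_ne: "\<And>n. n \<ge> 1 \<Longrightarrow> C n \<noteq> {}"
    and A3_cpt: "\<exists>K. compact K \<and> (\<forall>n\<ge>1. (\<lambda>i. f (x n i)) ` C n \<subseteq> K)"
    and A4: "(\<Inter>y\<in>inner_limit (\<lambda>n. (\<lambda>i. f (x n i)) ` C n). mat_mgf_domain M (Z 1) y)
           = (\<Inter>y\<in>outer_limit (\<lambda>n. (\<lambda>i. f (x n i)) ` C n). mat_mgf_domain M (Z 1) y)"
  shows "LDP M (\<lambda>n \<omega>. (1 / real n) *\<^sub>R (\<Sum>i\<in>C n. f (x n i) *v Z i \<omega>))
           (support_fun (\<Inter>y\<in>inner_limit (\<lambda>n. (\<lambda>i. f (x n i)) ` C n). mat_mgf_domain M (Z 1) y))"
proof -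
  obtain \<alpha> where \<alpha>: "0 < \<alpha>" "(\<integral>\<^sup>+\<omega>. ennreal (exp (\<alpha> * norm (Z 1 \<omega>))) \<partial>M) < \<infinity>"
    using A1_exp by blast
  obtain K where K: "compact K" "\<And>n. 1 \<le> n \<Longrightarrow> (\<lambda>i. f (x n i)) ` C n \<subseteq> K"
    using A3_cpt by blast
  interpret prob_space M
    by (rule prob)
  interpret weighted_iid_sums M Z "\<lambda>n i. f (x n i)" C \<alpha> K
  proof
    show "finite (C n)" for n
      using C_sub[of n] by (rule finite_subset) simp
  qed (rule indep ident \<alpha> K C_card A3_ne; assumption)+
  \<comment> \<open>Moving each weight across the inner product turns the stated domains into
    \<open>dual_domain\<close>, so \<open>A4\<close> becomes the hypothesis
    \<open>eq\<close>.\<close>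
  have D: "(\<Inter>y\<in>Y. mat_mgf_domain M (Z 1) y) = dual_domain Y" for Y
    by (auto simp: dual_domain_def mat_mgf_domain_eq)
  show ?thesis
    using LDP_weighted_mean[OF A1A2_LDP A4[unfolded D]] unfolding D weighted_mean_def[abs_def] .
qed

end
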